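(* Let $p\in(\vec{p}_c,1)$ and let $G$ be the random oriented graph formed by the right-most infinite open paths $\gamma_u$, $u\in\mathcal{K}$, of oriented percolation with parameter $p$ on $\mathcal{L}$. Then, almost surely, $G$ has one topological end.
   Context: Oriented percolation. Let $\mathcal{L}=\{(m,n)\in\mathbb{Z}^2: m+n \text{ is even}\}$, with oriented edges from $(m,n)$ to $(m+1,n+1)$ and to $(m-1,n+1)$. Each edge is independently open with probability $p$ and closed with probability $1-p$; $\mathbb{P}_p$ is the product measure. For $u,v\in\mathcal{L}$ write $u\to v$ if there is a (possibly trivial) oriented path of open edges from $u$ to $v$. Let $C_u=\{v\in\mathcal{L}:u\to v\}$, $\theta(p)=\mathbb{P}_p(|C_{(0,0)}|=\infty)$, and $\vec{p}_c=\sup\{p:\theta(p)=0\}$; it is known that $0<\vec{p}_c<1$. A vertex $u$ is a percolation point if $|C_u|=\infty$, and $\mathcal{K}=\{u\in\mathcal{L}:|C_u|=\infty\}$. Right-most paths. For $(x,y)\in\mathcal{K}$, the right-most infinite open path $\gamma_{(x,y)}$ is the infinite oriented open path with vertices $v_0=(x,y),v_1,v_2,\dots$, $v_n=(x_n,y_n)$ (each edge from $v_{n-1}$ to $v_n$ being an open oriented edge), such that for every $n\ge 1$ there is no integer $k\ge1$ with $(x,y)\to(x_n+k,y_n)$ and $(x_n+k,y_n)\in\mathcal{K}$. The graph $G$. $G$ is the union of the paths $\gamma_u$, $u\in\mathcal{K}$: its vertex set is $\mathcal{K}$ and its edges are the (open) edges belonging to some $\gamma_u$, $u\in\mathcal{K}$.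 Topological ends. A 1-way infinite path in the graph $G$ (edge orientations disregarded) is called a ray. If finitely many vertices are removed from a ray, the infinite connected part that remains is again a ray, called a tail of the ray. Two rays are equivalent if they have the same tail (i.e. they share a common tail). This is an equivalence relation on the set of rays in $G$, and its equivalence classes are the topological ends of $G$. *)

theory Defs
  imports "HOL-Probability.Probability"
begin

section \<open>Oriented percolation on the even sublattice of the square lattice\<close>

type_synonym vertex = "int \<times> int"
type_synonym edge = "vertex \<times> vertex"
type_synonym config = "edge \<Rightarrow> bool"

definition lattice :: "vertex set" where
  "lattice = {(m, n). even (m + n)}"

definition lattice_edges :: "edge set" where
  "lattice_edges =
     {(u, v). u \<in> lattice \<and>
        (v = (fst u + 1, snd u + 1) \<or> v = (fst u - 1, snd u + 1))}"

definition perc :: "real \<Rightarrow> config measure" where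
  "perc p = PiM lattice_edges (\<lambda>_. measure_pmf (bernoulli_pmf p))"

definition open_edges :: "config \<Rightarrow> edge set" where
  "open_edges \<omega> = {e \<in> lattice_edges. \<omega> e}"

definition reaches :: "config \<Rightarrow> vertex \<Rightarrow> vertex \<Rightarrow> bool" where
  "reaches \<omega> u v \<longleftrightarrow> (u, v) \<in> (open_edges \<omega>)\<^sup>*"

definition cluster :: "config \<Rightarrow> vertex \<Rightarrow> vertex set" where
  "cluster \<omega> u = {v \<in> lattice. reaches \<omega> u v}"

definition theta :: "real \<Rightarrow> real" where
  "theta p = measure (perc p) {\<omega> \<in> space (perc p). infinite (cluster \<omega> (0, 0))}"

text \<open>The parameter has to be restricted to the unit interval explicitly:
  \<^const>\<open>bernoulli_pmf\<close> is defined (by clamping) for all reals.\<close>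

definition critical_prob :: real where
  "critical_prob = Sup {p \<in> {0..1}. theta p = 0}"

definition percolation_points :: "config \<Rightarrow> vertex set" where
  "percolation_points \<omega> = {u \<in> lattice. infinite (cluster \<omega> u)}"


section \<open>Right-most paths and the graph they form\<close>

definition is_rightmost_path :: "config \<Rightarrow> vertex \<Rightarrow> (nat \<Rightarrow> vertex) \<Rightarrow> bool" where
  "is_rightmost_path \<omega> u \<gamma> \<longleftrightarrow>
     \<gamma> 0 = u \<and>
     (\<forall>n. (\<gamma> n, \<gamma> (Suc n)) \<in> open_edges \<omega>) \<and>
     (\<forall>n\<ge>1. \<not> (\<exists>k\<ge>1. reaches \<omega> u (fst (\<gamma> n) + k, snd (\<gamma> n)) \<and>
                       (fst (\<gamma> n) + k, snd (\<gamma> n)) \<in> percolation_points \<omega>))"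

text \<open>Well-defined for every percolation point, see \<open>ex1_rightmost_path\<close> below.\<close>

definition rightmost_path :: "config \<Rightarrow> vertex \<Rightarrow> nat \<Rightarrow> vertex" where
  "rightmost_path \<omega> u = (THE \<gamma>. is_rightmost_path \<omega> u \<gamma>)"

definition rightmost_edges :: "config \<Rightarrow> edge set" where
  "rightmost_edges \<omega> =
     (\<Union>u\<in>percolation_points \<omega>.
        {(rightmost_path \<omega> u n, rightmost_path \<omega> u (Suc n)) | n. True})"


section \<open>Topological ends\<close>

text \<open>A ray is represented by the sequence of its (distinct) vertices, starting at its
  unique vertex of degree one.  Removing finitely many vertices from a ray leaves exactly
  one infinite connected part, namely a shift of that sequence.\<close>

definition rays :: "'a set \<Rightarrow> ('a \<times> 'a) set \<Rightarrow> (nat \<Rightarrow> 'a) set" where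
  "rays V A =
     {r. inj r \<and> range r \<subseteq> V \<and>
         (\<forall>n. (r n, r (Suc n)) \<in> A \<or> (r (Suc n), r n) \<in> A)}"

definition is_tail :: "(nat \<Rightarrow> 'a) \<Rightarrow> (nat \<Rightarrow> 'a) \<Rightarrow> bool" where
  "is_tail t r \<longleftrightarrow> (\<exists>k. t = (\<lambda>n. r (n + k)))"

definition ray_equiv :: "'a set \<Rightarrow> ('a \<times> 'a) set \<Rightarrow> ((nat \<Rightarrow> 'a) \<times> (nat \<Rightarrow> 'a)) set" where
  "ray_equiv V A =
     {(r, s). r \<in> rays V A \<and> s \<in> rays V A \<and> (\<exists>t. is_tail t r \<and> is_tail t s)}"

definition topological_ends :: "'a set \<Rightarrow> ('a \<times> 'a) set \<Rightarrow> (nat \<Rightarrow> 'a) set set" where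
  "topological_ends V A = rays V A // ray_equiv V A"


section \<open>Well-definedness\<close>

lemma equiv_ray_equiv: "equiv (rays V A) (ray_equiv V A)"
proof (rule equivI)
  show "ray_equiv V A \<subseteq> rays V A \<times> rays V A"
    by (auto simp: ray_equiv_def)
  show "refl_on (rays V A) (ray_equiv V A)"
    by (auto simp: refl_on_def ray_equiv_def is_tail_def)
  show "sym (ray_equiv V A)"
    by (auto simp: sym_def ray_equiv_def)
  show "trans (ray_equiv V A)"
  proof (rule transI)
    fix r s q
    assume "(r, s) \<in> ray_equiv V A" "(s, q) \<in> ray_equiv V A"
    then obtain a b c d where
      mem: "r \<in> rays V A" "q \<in> rays V A"
      and 1: "(\<lambda>n. r (n + a)) = (\<lambda>n. s (n + b))"
      and 2: "(\<lambda>n. s (n + c)) = (\<lambda>n. q (n + d))"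
      unfolding ray_equiv_def is_tail_def by auto
    have "r (n + (c + a)) = q (n + (d + b))" for n
      using fun_cong[OF 1, of "n + c"] fun_cong[OF 2, of "n + b"]
      by (simp add: ac_simps)
    then have "(\<lambda>n. r (n + (c + a))) = (\<lambda>n. q (n + (d + b)))"
      by (rule ext)
    then have "is_tail (\<lambda>n. r (n + (c + a))) r" "is_tail (\<lambda>n. r (n + (c + a))) q"
      unfolding is_tail_def by blast+
    with mem show "(r, q) \<in> ray_equiv V A"
      by (auto simp: ray_equiv_def)
  qed
qed

lemma open_edgeD:
  assumes "(u, v) \<in> open_edges \<omega>"
  shows "u \<in> lattice" "v \<in> lattice" "snd v = snd u + 1" "\<bar>fst v - fst u\<bar> = 1"
  using assms by (auto simp: open_edges_def lattice_edges_def lattice_def)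

lemma reaches_lattice:
  assumes "reaches \<omega> u v" "u \<in> lattice"
  shows "v \<in> lattice"
  using assms(1) unfolding reaches_def
  by (induction rule: rtrancl_induct) (auto simp: assms(2) dest: open_edgeD)

lemma reaches_cone:
  assumes "reaches \<omega> u v"
  shows "snd v \<ge> snd u \<and> \<bar>fst v - fst u\<bar> \<le> snd v - snd u"
  using assms unfolding reaches_def
proof (induction rule: rtrancl_induct)
  case (step y z)
  then show ?case using open_edgeD[OF step(2)] by linarith
qed simp

lemma percolation_point_back:
  assumes "reaches \<omega> w v" "w \<in> lattice" "v \<in> percolation_points \<omega>"
  shows "w \<in> percolation_points \<omega>"
proof -
  have "cluster \<omega> v \<subseteq> cluster \<omega> w"
    using assms(1) by (auto simp: cluster_def reaches_def)
  with assms(2,3) show ?thesis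
    by (auto simp: percolation_points_def dest: infinite_super)
qed

lemma percolation_point_child:
  assumes "w \<in> percolation_points \<omega>"
  obtains v where "(w, v) \<in> open_edges \<omega>" "v \<in> percolation_points \<omega>"
proof -
  let ?a = "(fst w + 1, snd w + 1)" and ?b = "(fst w - 1, snd w + 1)"
  have *: "v = w \<or> (\<exists>c\<in>{?a, ?b}. (w, c) \<in> open_edges \<omega> \<and> v \<in> cluster \<omega> c)"
    if "v \<in> cluster \<omega> w" for v
  proof -
    from that have "(w, v) \<in> (open_edges \<omega>)\<^sup>*" "v \<in> lattice"
      by (auto simp: cluster_def reaches_def)
    then show ?thesis
    proof (cases rule: converse_rtranclE)
      case (step c)
      then have "c \<in> {?a, ?b}"
        by (auto simp: open_edges_def lattice_edges_def)
      with step \<open>v \<in> lattice\<close> show ?thesis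
        by (auto simp: cluster_def reaches_def)
    qed simp
  qed
  have "\<exists>c. (w, c) \<in> open_edges \<omega> \<and> infinite (cluster \<omega> c)"
  proof (rule ccontr)
    assume neg: "\<not> ?thesis"
    let ?S = "{c \<in> {?a, ?b}. (w, c) \<in> open_edges \<omega>}"
    have "cluster \<omega> w \<subseteq> insert w (\<Union>c\<in>?S. cluster \<omega> c)"
      using * by blast
    moreover have "finite (insert w (\<Union>c\<in>?S. cluster \<omega> c))"
      using neg by (intro finite.insertI finite_UN_I) auto
    ultimately show False
      using assms by (auto simp: percolation_points_def dest: finite_subset)
  qed
  then show ?thesis
    using that by (auto simp: percolation_points_def dest: open_edgeD)
qed

lemma is_rightmost_path_reaches:
  assumes "is_rightmost_path \<omega> u \<gamma>"
  shows "reaches \<omega> (\<gamma> m) (\<gamma> (m + n))" "snd (\<gamma> n) = snd u + int n"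
proof -
  have e: "(\<gamma> n, \<gamma> (Suc n)) \<in> open_edges \<omega>" for n
    using assms by (auto simp: is_rightmost_path_def)
  show "reaches \<omega> (\<gamma> m) (\<gamma> (m + n))"
    unfolding reaches_def by (induction n) (auto intro: e rtrancl_into_rtrancl)
  show "snd (\<gamma> n) = snd u + int n"
  proof (induction n)
    case 0
    show ?case using assms by (simp add: is_rightmost_path_def)
  next
    case (Suc n)
    then show ?case using open_edgeD(3)[OF e[of n]] by simp
  qed
qed

lemma is_rightmost_path_percolation_point:
  assumes "is_rightmost_path \<omega> u \<gamma>"
  shows "\<gamma> m \<in> percolation_points \<omega>"
proof -
  have e: "(\<gamma> n, \<gamma> (Suc n)) \<in> open_edges \<omega>" for n
    using assms by (auto simp: is_rightmost_path_def)
  have "inj (\<lambda>n. \<gamma> (m + n))"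
    by (rule inj_on_inverseI[where g = "\<lambda>v. nat (snd v - snd u) - m"])
       (simp add: is_rightmost_path_reaches(2)[OF assms])
  then have "infinite (range (\<lambda>n. \<gamma> (m + n)))"
    by (rule range_inj_infinite)
  moreover have "range (\<lambda>n. \<gamma> (m + n)) \<subseteq> cluster \<omega> (\<gamma> m)"
    using is_rightmost_path_reaches(1)[OF assms] open_edgeD(1)[OF e]
    by (auto simp: cluster_def)
  ultimately show ?thesis
    using open_edgeD(1)[OF e] by (auto simp: percolation_points_def dest: infinite_super)
qed

lemma ex1_rightmost_path:
  assumes u: "u \<in> percolation_points \<omega>"
  shows "\<exists>!\<gamma>. is_rightmost_path \<omega> u \<gamma>"
proof (rule ex_ex1I)
  have uL: "u \<in> lattice" using u by (simp add: percolation_points_def)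
  define pt where "pt n x = (x, snd u + int n)" for n :: nat and x :: int
  define R where "R n = {x. reaches \<omega> u (pt n x) \<and> pt n x \<in> percolation_points \<omega>}" for n
  have fin: "finite (R n)" for n
  proof (rule finite_subset)
    show "R n \<subseteq> {fst u - int n .. fst u + int n}"
      by (auto simp: R_def pt_def dest!: reaches_cone)
  qed simp
  have step: "\<exists>y\<in>R (Suc n). (pt n x, pt (Suc n) y) \<in> open_edges \<omega>" if x: "x \<in> R n" for n x
  proof -
    from x obtain v where v: "(pt n x, v) \<in> open_edges \<omega>" "v \<in> percolation_points \<omega>"
      by (auto simp: R_def elim: percolation_point_child)
    have "v = pt (Suc n) (fst v)"
      using open_edgeD(3)[OF v(1)] by (cases v) (simp add: pt_def)
    with v x show ?thesis
      by (intro bexI[of _ "fst v"]) (auto simp: R_def reaches_def)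
  qed
  have pred: "\<exists>x\<in>R n. (pt n x, pt (Suc n) y) \<in> open_edges \<omega>" if y: "y \<in> R (Suc n)" for n y
  proof -
    from y have "(u, pt (Suc n) y) \<in> (open_edges \<omega>)\<^sup>*"
      by (simp add: R_def reaches_def)
    moreover have "u \<noteq> pt (Suc n) y" by (cases u) (simp add: pt_def)
    ultimately obtain w where w: "(u, w) \<in> (open_edges \<omega>)\<^sup>*" "(w, pt (Suc n) y) \<in> open_edges \<omega>"
      by (auto elim: rtranclE)
    have weq: "w = pt n (fst w)"
      using open_edgeD(3)[OF w(2)] by (cases w) (simp add: pt_def)
    have "reaches \<omega> w (pt (Suc n) y)"
      using w(2) by (auto simp: reaches_def)
    then have "w \<in> percolation_points \<omega>"
      using percolation_point_back open_edgeD(1)[OF w(2)] y by (auto simp: R_def)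
    with w weq show ?thesis
      by (intro bexI[of _ "fst w"]) (auto simp: R_def reaches_def)
  qed
  have ne: "R n \<noteq> {}" for n
  proof (induction n)
    case 0
    have "fst u \<in> R 0" using u by (simp add: R_def pt_def reaches_def)
    then show ?case by auto
  qed (use step in blast)
  define r where "r n = Max (R n)" for n
  have r: "r n \<in> R n" "x \<in> R n \<Longrightarrow> x \<le> r n" for n x
    using fin ne by (auto simp: r_def)
  have edge: "(pt n (r n), pt (Suc n) (r (Suc n))) \<in> open_edges \<omega>" for n
  proof -
    obtain a where a: "a \<in> R n" "(pt n a, pt (Suc n) (r (Suc n))) \<in> open_edges \<omega>"
      using pred r(1) by blast
    obtain b where b: "b \<in> R (Suc n)" "(pt n (r n), pt (Suc n) b) \<in> open_edges \<omega>"
      using step r(1) by blast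
    have "even (r n + (snd u + int n))" "even (a + (snd u + int n))"
      using open_edgeD(1)[OF a(2)] open_edgeD(1)[OF b(2)] by (auto simp: lattice_def pt_def)
    then have "even ((r n + (snd u + int n)) - (a + (snd u + int n)))"
      by (rule dvd_diff)
    then have "2 dvd r n - a" by (simp only: add_diff_cancel_right)
    then obtain d where "r n - a = 2 * d" by (rule dvdE)
    moreover have "a \<le> r n" "b \<le> r (Suc n)" using r a b by auto
    moreover have "\<bar>r (Suc n) - a\<bar> = 1" "\<bar>b - r n\<bar> = 1"
      using open_edgeD(4)[OF a(2)] open_edgeD(4)[OF b(2)] by (auto simp: pt_def)
    moreover have "d = 0 \<or> d \<ge> 1" using calculation by linarith
    ultimately have "a = r n \<or> b = r (Suc n)" by (elim disjE) linarith+
    with a b show ?thesis by auto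
  qed
  show "\<exists>\<gamma>. is_rightmost_path \<omega> u \<gamma>"
  proof (rule exI[of _ "\<lambda>n. pt n (r n)"], unfold is_rightmost_path_def, intro conjI allI impI)
    show "pt 0 (r 0) = u"
      using r(1)[of 0] by (auto simp: R_def pt_def prod_eq_iff dest!: reaches_cone)
    show "(pt n (r n), pt (Suc n) (r (Suc n))) \<in> open_edges \<omega>" for n by (rule edge)
    show "\<not> (\<exists>k\<ge>1. reaches \<omega> u (fst (pt n (r n)) + k, snd (pt n (r n))) \<and>
                   (fst (pt n (r n)) + k, snd (pt n (r n))) \<in> percolation_points \<omega>)" for n
    proof
      assume "\<exists>k\<ge>1. reaches \<omega> u (fst (pt n (r n)) + k, snd (pt n (r n))) \<and>
                   (fst (pt n (r n)) + k, snd (pt n (r n))) \<in> percolation_points \<omega>"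
      then obtain k where "k \<ge> 1" "r n + k \<in> R n"
        by (auto simp: R_def pt_def)
      with r(2)[of "r n + k" n] show False by simp
    qed
  qed
  fix \<gamma> \<gamma>' assume g: "is_rightmost_path \<omega> u \<gamma>" "is_rightmost_path \<omega> u \<gamma>'"
  have main: "fst (\<delta>' n) \<le> fst (\<delta> n)"
    if d: "is_rightmost_path \<omega> u \<delta>" and d': "is_rightmost_path \<omega> u \<delta>'" for \<delta> \<delta>' n
  proof (rule ccontr)
    assume less: "\<not> ?thesis"
    let ?k = "fst (\<delta>' n) - fst (\<delta> n)"
    have eq: "(fst (\<delta> n) + ?k, snd (\<delta> n)) = \<delta>' n"
      using is_rightmost_path_reaches(2)[OF d] is_rightmost_path_reaches(2)[OF d']
      by (simp add: prod_eq_iff)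
    have zero: "\<delta> 0 = u" "\<delta>' 0 = u" using d d' by (auto simp: is_rightmost_path_def)
    have "n \<ge> 1" using less zero by (cases n) auto
    moreover have "?k \<ge> 1" using less by simp
    moreover have "reaches \<omega> u (\<delta>' n)"
      using is_rightmost_path_reaches(1)[OF d', of 0 n] zero by simp
    moreover note is_rightmost_path_percolation_point[OF d', of n]
    ultimately show False
      using d eq unfolding is_rightmost_path_def by metis
  qed
  show "\<gamma> = \<gamma>'"
    using main[OF g] main[OF g(2,1)] is_rightmost_path_reaches(2)[OF g(1)]
      is_rightmost_path_reaches(2)[OF g(2)]
    by (auto simp: prod_eq_iff fun_eq_iff intro: antisym)
qed

end

theory Submission
  imports Defs
begin

text \<open>
  Every percolation point has a successor: its upper right neighbour, if that is a percolation point
  and the edge to it is open, and otherwise its upper left neighbour.  The right-most path from a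
  percolation point is its orbit under this map (\<open>rightmost_path_eq_rm_iter\<close>), so \<open>G\<close> is a forest in
  which every vertex has one edge upwards.  A ray that goes down once has to go down forever.  Hence
  \<open>G\<close> has exactly one end if there is a percolation point, if no vertex is eternal, that is,
  has ancestors in all generations, and if any two orbits meet (\<open>one_end\<close>).

  No vertex is eternal.  An eternal point has an eternal parent, and by translation invariance it
  has one eternal parent on average, so almost surely exactly one: the successor map is injective on
  the eternal points (\<open>AE_inj_on_eternal_points\<close>).  If a level contained two eternal points, then
  changing the states of finitely many edges would lead the orbit of the left one into the orbit of
  the right one without cutting either line of descent (\<open>merging_eternal_points\<close>).  As \<open>0 < p < 1\<close>,
  such changes turn events of positive probability into events of positive probability
  (\<open>AE_override_on\<close>), which contradicts the injectivity.  So a level contains at most one eternal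
  point, and as all points of a level are equally likely to be eternal, there is none
  (\<open>prob_eternal_point\<close>).

  Any two orbits meet.  Orbits do not cross.  If the orbits of two points of one level never meet,
  then the right-most point whose orbit meets that of the left one is, at all times \<open>n\<close>, the
  right-most among the points whose orbits agree with its own after \<open>n\<close> steps.  Each of the points
  that orbits occupy after \<open>n\<close> steps corresponds to one right-most point.  By translation invariance
  the probability to be right-most at time \<open>n\<close> is therefore at most the probability to have an
  ancestor \<open>n\<close> levels below (\<open>prob_class_top_le\<close>), which tends to the probability to be
  eternal, zero.

  Percolation points exist almost surely by Kolmogorov's zero-one law, since the origin is one with
  probability \<open>theta p > 0\<close>.
\<close>


section \<open>The graph as the orbit forest of a map\<close>

definition diag :: "vertex \<Rightarrow> nat \<Rightarrow> vertex" where
  "diag v n = (fst v + int n, snd v + int n)"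

text \<open>The left child is taken by default: a percolation point whose right child is not a percolation
  point reached by an open edge has such a left child.\<close>

definition rm_step :: "config \<Rightarrow> vertex \<Rightarrow> vertex" where
  "rm_step \<omega> v =
     (if (v, diag v 1) \<in> open_edges \<omega> \<and> diag v 1 \<in> percolation_points \<omega>
      then diag v 1 else (fst v - 1, snd v + 1))"

abbreviation rm_iter :: "config \<Rightarrow> nat \<Rightarrow> vertex \<Rightarrow> vertex" where
  "rm_iter \<omega> n \<equiv> rm_step \<omega> ^^ n"

lemma snd_rm_step [simp]: "snd (rm_step \<omega> v) = snd v + 1"
  by (simp add: rm_step_def diag_def)

lemma fst_rm_step: "fst (rm_step \<omega> v) = fst v + 1 \<or> fst (rm_step \<omega> v) = fst v - 1"
  by (simp add: rm_step_def diag_def)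

lemma snd_rm_iter [simp]: "snd (rm_iter \<omega> n v) = snd v + int n"
  by (induction n) auto

lemma fst_rm_iter_le: "\<bar>fst (rm_iter \<omega> n v) - fst v\<bar> \<le> int n"
proof (induction n)
  case (Suc n)
  then show ?case using fst_rm_step[of \<omega> "rm_iter \<omega> n v"] by auto
qed simp

lemma lattice_parity: "v \<in> lattice \<longleftrightarrow> even (fst v + snd v)"
  by (auto simp: lattice_def split: prod.splits)

lemma rm_step_lattice: "rm_step \<omega> v \<in> lattice \<longleftrightarrow> v \<in> lattice"
  using fst_rm_step[of \<omega> v] by (auto simp: lattice_parity)

lemma rm_iter_lattice: "rm_iter \<omega> n v \<in> lattice \<longleftrightarrow> v \<in> lattice"
  by (induction n) (auto simp: rm_step_lattice)

lemma percolation_points_lattice: "v \<in> percolation_points \<omega> \<Longrightarrow> v \<in> lattice"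
  by (simp add: percolation_points_def)

lemma open_edge_cases:
  assumes "(u, v) \<in> open_edges \<omega>"
  shows "v = diag u 1 \<or> v = (fst u - 1, snd u + 1)"
  using assms by (auto simp: open_edges_def lattice_edges_def diag_def)

lemma rm_step_percolation_point:
  assumes "v \<in> percolation_points \<omega>"
  shows "(v, rm_step \<omega> v) \<in> open_edges \<omega>" "rm_step \<omega> v \<in> percolation_points \<omega>"
proof -
  obtain w where "(v, w) \<in> open_edges \<omega>" "w \<in> percolation_points \<omega>"
    using percolation_point_child[OF assms] by blast
  with open_edge_cases[OF this(1)]
  show "(v, rm_step \<omega> v) \<in> open_edges \<omega>" "rm_step \<omega> v \<in> percolation_points \<omega>"
    by (auto simp: rm_step_def)
qed

lemma rm_iter_percolation_point:
  "v \<in> percolation_points \<omega> \<Longrightarrow> rm_iter \<omega> n v \<in> percolation_points \<omega>"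
  by (induction n) (auto intro: rm_step_percolation_point)

lemma rm_step_rightmost_child:
  assumes "(u, v) \<in> open_edges \<omega>" "v \<in> percolation_points \<omega>"
  shows "fst v \<le> fst (rm_step \<omega> u)"
  using open_edge_cases[OF assms(1)] assms by (auto simp: rm_step_def diag_def)

text \<open>Distinct lattice points of one level are at least two apart, whereas a step moves by one.
  Orbits can therefore meet, but never cross.\<close>

lemma level_gap:
  assumes "u \<in> lattice" "v \<in> lattice" "snd u = snd v" "fst u < fst v"
  shows "fst u + 2 \<le> fst v"
proof -
  have "even (fst u + snd u)" "even (fst v + snd v)" using assms by (auto simp: lattice_parity)
  then have "even (fst v - fst u)" using assms(3) by presburger
  then show ?thesis using assms(4) by presburger
qed

lemma rm_step_mono:
  assumes "u \<in> lattice" "v \<in> lattice" "snd u = snd v" "fst u \<le> fst v"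
  shows "fst (rm_step \<omega> u) \<le> fst (rm_step \<omega> v)"
proof (cases "fst u = fst v")
  case True
  then have "u = v" using assms(3) by (simp add: prod_eq_iff)
  then show ?thesis by simp
next
  case False
  then show ?thesis
    using level_gap[OF assms(1-3)] assms(4) fst_rm_step[of \<omega> u] fst_rm_step[of \<omega> v] by auto
qed

lemma rm_iter_mono:
  assumes "u \<in> lattice" "v \<in> lattice" "snd u = snd v" "fst u \<le> fst v"
  shows "fst (rm_iter \<omega> n u) \<le> fst (rm_iter \<omega> n v)"
  by (induction n) (auto intro!: rm_step_mono simp: rm_iter_lattice assms)

lemma reaches_rm_iter:
  assumes "v \<in> percolation_points \<omega>"
  shows "reaches \<omega> v (rm_iter \<omega> n v)"
  unfolding reaches_def
  by (induction n)
     (auto intro: rtrancl_into_rtrancl rm_step_percolation_point rm_iter_percolation_point assms)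

text \<open>The orbit stays weakly to the right of every percolation point that its origin reaches: such a
  point has a percolation point as predecessor on the open path from the origin, which by induction
  is not to the right of the orbit, and steps preserve the order within a level.\<close>

lemma rightmost_path_eq_rm_iter:
  assumes u: "u \<in> percolation_points \<omega>"
  shows "rightmost_path \<omega> u = (\<lambda>n. rm_iter \<omega> n u)"
proof -
  have bound: "fst v \<le> fst (rm_iter \<omega> n u)"
    if "reaches \<omega> u v" "v \<in> percolation_points \<omega>" "snd v = snd u + int n" for v n
    using that
  proof (induction n arbitrary: v)
    case 0
    then show ?case using reaches_cone[of \<omega> u v] by auto
  next
    case (Suc n)
    have "(u, v) \<in> (open_edges \<omega>)\<^sup>*" "u \<noteq> v" using Suc.prems by (auto simp: reaches_def)
    then obtain w where w: "(u, w) \<in> (open_edges \<omega>)\<^sup>*" "(w, v) \<in> open_edges \<omega>"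
      by (auto elim: rtranclE)
    have wl: "w \<in> lattice" using w(2) by (rule open_edgeD)
    have ws: "snd w = snd u + int n" using open_edgeD(3)[OF w(2)] Suc.prems(3) by simp
    have "w \<in> percolation_points \<omega>"
      using percolation_point_back[of \<omega> w v] w wl Suc.prems by (auto simp: reaches_def)
    then have "fst w \<le> fst (rm_iter \<omega> n u)"
      using Suc.IH[of w] w ws by (auto simp: reaches_def)
    then have "fst (rm_step \<omega> w) \<le> fst (rm_step \<omega> (rm_iter \<omega> n u))"
      using ws wl percolation_points_lattice[OF u] by (intro rm_step_mono) (auto simp: rm_iter_lattice)
    then show ?case
      using rm_step_rightmost_child[OF w(2) Suc.prems(2)] by simp
  qed
  have "is_rightmost_path \<omega> u (\<lambda>n. rm_iter \<omega> n u)"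
    unfolding is_rightmost_path_def
  proof (intro conjI allI impI notI)
    fix n :: nat
    show "(rm_iter \<omega> n u, rm_iter \<omega> (Suc n) u) \<in> open_edges \<omega>"
      using rm_step_percolation_point[OF rm_iter_percolation_point[OF u]] by simp
    assume "\<exists>k\<ge>1. reaches \<omega> u (fst (rm_iter \<omega> n u) + k, snd (rm_iter \<omega> n u)) \<and>
      (fst (rm_iter \<omega> n u) + k, snd (rm_iter \<omega> n u)) \<in> percolation_points \<omega>"
    then show False using bound[of "(fst (rm_iter \<omega> n u) + _, snd (rm_iter \<omega> n u))" n] by force
  qed simp
  then show ?thesis
    unfolding rightmost_path_def using the1_equality[OF ex1_rightmost_path[OF u]] by blast
qed

lemma rightmost_edges_eq:
  "rightmost_edges \<omega> = {(v, rm_step \<omega> v) | v. v \<in> percolation_points \<omega>}"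
proof -
  have "rightmost_edges \<omega> =
      {(rm_iter \<omega> n u, rm_iter \<omega> (Suc n) u) | u n. u \<in> percolation_points \<omega>}"
    unfolding rightmost_edges_def using rightmost_path_eq_rm_iter by fastforce
  also have "\<dots> = {(v, rm_step \<omega> v) | v. v \<in> percolation_points \<omega>}"
  proof (intro subset_antisym subsetI)
    fix e assume "e \<in> {(v, rm_step \<omega> v) | v. v \<in> percolation_points \<omega>}"
    then obtain v where "e = (rm_iter \<omega> 0 v, rm_iter \<omega> (Suc 0) v)" "v \<in> percolation_points \<omega>"
      by auto
    then show "e \<in> {(rm_iter \<omega> n u, rm_iter \<omega> (Suc n) u) | u n. u \<in> percolation_points \<omega>}"
      by blast
  next
    fix e assume "e \<in> {(rm_iter \<omega> n u, rm_iter \<omega> (Suc n) u) | u n. u \<in> percolation_points \<omega>}"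
    then obtain u n where "e = (rm_iter \<omega> n u, rm_step \<omega> (rm_iter \<omega> n u))" "u \<in> percolation_points \<omega>"
      by auto
    then show "e \<in> {(v, rm_step \<omega> v) | v. v \<in> percolation_points \<omega>}"
      using rm_iter_percolation_point by blast
  qed
  finally show ?thesis .
qed

section \<open>Vertices with infinitely long lines of descent\<close>

definition has_ancestor :: "config \<Rightarrow> nat \<Rightarrow> vertex \<Rightarrow> bool" where
  "has_ancestor \<omega> n v \<longleftrightarrow> (\<exists>u\<in>percolation_points \<omega>. rm_iter \<omega> n u = v)"

definition eternal_points :: "config \<Rightarrow> vertex set" where
  "eternal_points \<omega> = {v. \<forall>n. has_ancestor \<omega> n v}"

lemma has_ancestor_percolation_point:
  "has_ancestor \<omega> n v \<Longrightarrow> v \<in> percolation_points \<omega>"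
  by (auto simp: has_ancestor_def intro: rm_iter_percolation_point)

lemma eternal_point_percolation_point:
  "v \<in> eternal_points \<omega> \<Longrightarrow> v \<in> percolation_points \<omega>"
  by (auto simp: eternal_points_def intro: has_ancestor_percolation_point)

lemma has_ancestor_antimono:
  assumes "has_ancestor \<omega> n v" "m \<le> n"
  shows "has_ancestor \<omega> m v"
proof -
  obtain u where u: "u \<in> percolation_points \<omega>" "rm_iter \<omega> n u = v"
    using assms by (auto simp: has_ancestor_def)
  have "rm_iter \<omega> m (rm_iter \<omega> (n - m) u) = v"
    using u(2) assms(2) by (metis comp_apply funpow_add le_add_diff_inverse)
  then show ?thesis using u(1) by (auto simp: has_ancestor_def intro: rm_iter_percolation_point)
qed

lemma has_ancestor_rm_step:
  assumes "has_ancestor \<omega> n v" shows "has_ancestor \<omega> (Suc n) (rm_step \<omega> v)"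
  using assms by (auto simp: has_ancestor_def)

lemma eternal_points_rm_step:
  assumes "v \<in> eternal_points \<omega>"
  shows "rm_step \<omega> v \<in> eternal_points \<omega>"
  unfolding eternal_points_def
proof safe
  fix n
  have "has_ancestor \<omega> (Suc n) (rm_step \<omega> v)"
    using assms by (auto simp: eternal_points_def intro: has_ancestor_rm_step)
  then show "has_ancestor \<omega> n (rm_step \<omega> v)" by (rule has_ancestor_antimono) simp
qed

lemma eternal_points_rm_iter:
  "v \<in> eternal_points \<omega> \<Longrightarrow> rm_iter \<omega> n v \<in> eternal_points \<omega>"
  by (induction n) (auto intro: eternal_points_rm_step)

lemma rm_step_parents:
  assumes "rm_step \<omega> u = v"
  shows "u = (fst v - 1, snd v - 1) \<or> u = (fst v + 1, snd v - 1)"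
  using fst_rm_step[of \<omega> u] snd_rm_step[of \<omega> u] assms by (auto simp: prod_eq_iff)

text \<open>This is Koenig's lemma for trees in which a vertex has at most two parents: if neither parent
  were eternal, the line of descent of \<open>v\<close> would have bounded length.\<close>

lemma eternal_point_parent:
  assumes v: "v \<in> eternal_points \<omega>"
  shows "\<exists>u\<in>{(fst v - 1, snd v - 1), (fst v + 1, snd v - 1)}. u \<in> eternal_points \<omega> \<and> rm_step \<omega> u = v"
proof (rule ccontr)
  assume neg: "\<not> ?thesis"
  define P where "P = {u \<in> {(fst v - 1, snd v - 1), (fst v + 1, snd v - 1)}. rm_step \<omega> u = v}"
  have "\<forall>u\<in>P. \<exists>n. \<not> has_ancestor \<omega> n u"
    using neg by (auto simp: P_def eternal_points_def)
  then obtain f where f: "\<And>u. u \<in> P \<Longrightarrow> \<not> has_ancestor \<omega> (f u) u" by metis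
  have "finite P" by (simp add: P_def)
  define N where "N = Max (insert 0 (f ` P))"
  have fN: "f u \<le> N" if "u \<in> P" for u using that \<open>finite P\<close> by (auto simp: N_def)
  obtain w where w: "w \<in> percolation_points \<omega>" "rm_iter \<omega> (Suc N) w = v"
    using v unfolding eternal_points_def has_ancestor_def by blast
  then have "rm_iter \<omega> N w \<in> P" using rm_step_parents[of \<omega> "rm_iter \<omega> N w" v] by (auto simp: P_def)
  moreover have "has_ancestor \<omega> N (rm_iter \<omega> N w)" using w by (auto simp: has_ancestor_def)
  ultimately show False using f fN has_ancestor_antimono by blast
qed

section \<open>Ends of the forest\<close>

text \<open>A ray cannot go backwards and then forwards: the vertex after a backward step has only one
  successor, which is already on the ray.  A ray with a backward step thus descends forever, and its
  vertices are eternal.  Without eternal points every ray is an orbit, and orbits that meet share a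
  tail.\<close>

lemma one_end:
  assumes ne: "percolation_points \<omega> \<noteq> {}"
    and eternal: "eternal_points \<omega> = {}"
    and coalesce: "\<And>u v. u \<in> percolation_points \<omega> \<Longrightarrow> v \<in> percolation_points \<omega> \<Longrightarrow>
      \<exists>m n. rm_iter \<omega> m u = rm_iter \<omega> n v"
  shows "card (topological_ends (percolation_points \<omega>) (rightmost_edges \<omega>)) = 1"
proof -
  let ?K = "percolation_points \<omega>" and ?E = "rightmost_edges \<omega>"
  have ray_rm_step: "r (Suc n) = rm_step \<omega> (r n)" if r: "r \<in> rays ?K ?E" for r n
  proof (rule ccontr)
    assume neg: "r (Suc n) \<noteq> rm_step \<omega> (r n)"
    have inj: "inj r" and K: "r i \<in> ?K"
      and adj: "r (Suc i) = rm_step \<omega> (r i) \<or> r i = rm_step \<omega> (r (Suc i))" for i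
      using r unfolding rays_def rightmost_edges_eq by blast+
    have backward: "r (n + i) = rm_step \<omega> (r (Suc (n + i)))" for i
    proof (induction i)
      case 0
      then show ?case using adj[of n] neg by simp
    next
      case (Suc i)
      have "r (Suc (Suc (n + i))) \<noteq> r (n + i)" using inj by (simp add: inj_eq)
      then show ?case using Suc adj[of "Suc (n + i)"] by auto
    qed
    have "rm_iter \<omega> i (r (n + i)) = r n" for i
      by (induction i) (use backward in \<open>auto simp: funpow_Suc_right simp del: funpow.simps\<close>)
    then have "r n \<in> eternal_points \<omega>"
      unfolding eternal_points_def has_ancestor_def using K by blast
    with eternal show False by simp
  qed
  have ray_eq: "r (n + k) = rm_iter \<omega> n (r k)" if "r \<in> rays ?K ?E" for r n k
    by (induction n) (use ray_rm_step[OF that] in auto)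
  have ray: "(\<lambda>n. rm_iter \<omega> n u) \<in> rays ?K ?E" if "u \<in> ?K" for u
  proof -
    have "inj (\<lambda>n. rm_iter \<omega> n u)"
      by (rule inj_on_inverseI[where g = "\<lambda>v. nat (snd v - snd u)"]) simp
    moreover have "(rm_iter \<omega> n u, rm_iter \<omega> (Suc n) u) \<in> ?E" for n
      unfolding rightmost_edges_eq using rm_iter_percolation_point[OF that, of n] by force
    ultimately show ?thesis
      using rm_iter_percolation_point[OF that] by (auto simp: rays_def)
  qed
  have equiv: "(r, s) \<in> ray_equiv ?K ?E" if "r \<in> rays ?K ?E" "s \<in> rays ?K ?E" for r s
  proof -
    have "r 0 \<in> ?K" "s 0 \<in> ?K" using that by (auto simp: rays_def)
    then obtain k l where "rm_iter \<omega> k (r 0) = rm_iter \<omega> l (s 0)" using coalesce by blast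
    then have "r k = s l" using ray_eq[OF that(1), of k 0] ray_eq[OF that(2), of l 0] by simp
    then have "(\<lambda>n. r (n + k)) = (\<lambda>n. s (n + l))" by (simp add: ray_eq that)
    then have "is_tail (\<lambda>n. r (n + k)) r" "is_tail (\<lambda>n. r (n + k)) s"
      unfolding is_tail_def by blast+
    then show ?thesis using that by (auto simp: ray_equiv_def)
  qed
  obtain r where r: "r \<in> rays ?K ?E" using ne ray by blast
  have "topological_ends ?K ?E = {ray_equiv ?K ?E `` {r}}"
    unfolding topological_ends_def quotient_def
    using r equiv equiv_class_eq[OF equiv_ray_equiv[of ?K ?E]] by blast
  then show ?thesis by simp
qed

section \<open>Comparing two configurations\<close>

text \<open>The cone of a vertex is finite up to each level, so an infinite cluster reaches all levels.
  This form makes measurability and translation invariance immediate.\<close>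

lemma percolation_point_iff:
  "v \<in> percolation_points \<omega> \<longleftrightarrow> v \<in> lattice \<and> (\<forall>n. \<exists>x. reaches \<omega> v (x, snd v + int n))"
proof (intro iffI conjI allI)
  fix n assume v: "v \<in> percolation_points \<omega>"
  then show "v \<in> lattice" by (rule percolation_points_lattice)
  show "\<exists>x. reaches \<omega> v (x, snd v + int n)"
    using reaches_rm_iter[OF v, of n] snd_rm_iter[of n \<omega> v] by (metis prod.collapse)
next
  assume a: "v \<in> lattice \<and> (\<forall>n. \<exists>x. reaches \<omega> v (x, snd v + int n))"
  then obtain x where x: "\<And>n. reaches \<omega> v (x n, snd v + int n)" by metis
  have "inj (\<lambda>n. (x n, snd v + int n))" by (auto simp: inj_def)
  then have "infinite (range (\<lambda>n. (x n, snd v + int n)))" by (rule range_inj_infinite)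
  moreover have "range (\<lambda>n. (x n, snd v + int n)) \<subseteq> cluster \<omega> v"
    using x a reaches_lattice[OF x] by (auto simp: cluster_def)
  ultimately show "v \<in> percolation_points \<omega>"
    using a by (auto simp: percolation_points_def dest: infinite_super)
qed

lemma percolation_points_mono:
  assumes "open_edges \<omega> \<subseteq> open_edges \<omega>'"
  shows "percolation_points \<omega> \<subseteq> percolation_points \<omega>'"
  using rtrancl_mono[OF assms] unfolding subset_iff percolation_point_iff reaches_def by blast

lemma percolation_point_if_orbit_open:
  assumes K: "v \<in> percolation_points \<omega>"
    and op: "\<And>n. (rm_iter \<omega> n v, rm_iter \<omega> (Suc n) v) \<in> open_edges \<omega>'"
  shows "v \<in> percolation_points \<omega>'"
proof -
  have "reaches \<omega>' v (rm_iter \<omega> n v)" for n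
    unfolding reaches_def by (induction n) (use op in \<open>auto intro: rtrancl_into_rtrancl\<close>)
  then have "reaches \<omega>' v (fst (rm_iter \<omega> n v), snd v + int n)" for n
    by (metis prod.collapse snd_rm_iter)
  then show ?thesis
    unfolding percolation_point_iff using K percolation_points_lattice by blast
qed

text \<open>Opening edges that start in \<open>S\<close> creates percolation points outside \<open>S\<close> only if an open path
  can get into \<open>S\<close> from there; it may do so at vertices that percolate anyway.\<close>

lemma percolation_points_modified_subset:
  assumes new: "\<And>u w. (u, w) \<in> open_edges \<omega>' \<Longrightarrow> (u, w) \<in> open_edges \<omega> \<or> u \<in> S"
    and enter: "\<And>u w. (u, w) \<in> open_edges \<omega>' \<Longrightarrow> w \<in> S \<Longrightarrow> u \<in> S \<or> w \<in> percolation_points \<omega>"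
  shows "percolation_points \<omega>' \<subseteq> percolation_points \<omega> \<union> S"
proof (rule ccontr)
  assume "\<not> ?thesis"
  then obtain v where v: "v \<in> percolation_points \<omega>'" "v \<notin> percolation_points \<omega>" "v \<notin> S" by blast
  have vl: "v \<in> lattice" using v by (simp add: percolation_points_lattice)
  have "reaches \<omega> v w \<and> w \<notin> S" if "reaches \<omega>' v w" for w
    using that unfolding reaches_def
  proof (induction rule: rtrancl_induct)
    case (step w z)
    then have "(w, z) \<in> open_edges \<omega>" using new by blast
    then have r: "(v, z) \<in> (open_edges \<omega>)\<^sup>*" using step by (auto intro: rtrancl_into_rtrancl)
    then have "z \<notin> percolation_points \<omega>"
      using percolation_point_back[of \<omega> v z] vl v(2) by (auto simp: reaches_def)
    then show ?case using r enter step by blast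
  qed (use v in auto)
  then have "v \<in> percolation_points \<omega>" using v(1) unfolding percolation_point_iff by blast
  with v(2) show False by blast
qed

text \<open>A step to the right stays available, and a step to the left stays forced, as long as
  the right child does not become eligible.\<close>

lemma rm_step_eqI:
  assumes "v \<in> percolation_points \<omega>" "rm_step \<omega> v \<in> percolation_points \<omega>'"
    and "(v, rm_step \<omega> v) \<in> open_edges \<omega>'"
    and "(v, diag v 1) \<in> open_edges \<omega>' \<Longrightarrow> diag v 1 \<in> percolation_points \<omega>' \<Longrightarrow>
      (v, diag v 1) \<in> open_edges \<omega> \<and> diag v 1 \<in> percolation_points \<omega>"
  shows "rm_step \<omega>' v = rm_step \<omega> v"
  using assms unfolding rm_step_def by (auto split: if_splits)

section \<open>Merging two lines of descent\<close>

text \<open>The modification that makes the orbit of \<open>x\<close> join that of an orbit further to the right: the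
  \<open>m\<close> edges of the rising diagonal from \<open>x\<close> are opened, and the edges that lead from the right onto
  the interior of that diagonal are closed.  No other edges enter its interior, so the vertices that
  can use the new edges are \<open>x\<close>, the diagonal, and what leads to \<open>x\<close>.\<close>

definition diag_edges :: "vertex \<Rightarrow> nat \<Rightarrow> edge set" where
  "diag_edges v m = (\<lambda>i. (diag v i, diag v (Suc i))) ` {..<m}"

definition side_edges :: "vertex \<Rightarrow> nat \<Rightarrow> edge set" where
  "side_edges v m = (\<lambda>i. ((fst v + int i + 1, snd v + int i - 1), diag v i)) ` {1..<m}"

definition open_diag :: "config \<Rightarrow> vertex \<Rightarrow> nat \<Rightarrow> config" where
  "open_diag \<omega> v m =
     override_on \<omega> (\<lambda>e. e \<in> diag_edges v m) (diag_edges v m \<union> side_edges v m)"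

lemma fst_diag [simp]: "fst (diag v n) = fst v + int n"
  and snd_diag [simp]: "snd (diag v n) = snd v + int n"
  and diag_0 [simp]: "diag v 0 = v"
  by (auto simp: diag_def)

lemma diag_inj [simp]: "diag v i = diag v j \<longleftrightarrow> i = j"
  by (auto simp: diag_def)

lemma diag_Suc: "diag (diag v i) (Suc 0) = diag v (Suc i)"
  by (simp add: diag_def)

lemma open_edges_open_diag:
  assumes "v \<in> lattice"
  shows "open_edges (open_diag \<omega> v m) = (open_edges \<omega> - side_edges v m) \<union> diag_edges v m"
proof -
  have "diag_edges v m \<subseteq> lattice_edges"
    using assms by (auto simp: diag_edges_def lattice_edges_def lattice_parity diag_def)
  moreover have "diag_edges v m \<inter> side_edges v m = {}"
    by (auto simp: diag_edges_def side_edges_def diag_def)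
  ultimately show ?thesis
    by (auto simp: open_edges_def open_diag_def override_on_def)
qed

text \<open>With \<open>m\<close> the first time at which the orbit of \<open>y\<close> meets the diagonal from \<open>x\<close>, opening the
  diagonal makes the orbits of \<open>x\<close> and \<open>y\<close> meet.  The change creates percolation points only on
  the diagonal strictly above \<open>x\<close>.  So on and below the level of \<open>x\<close> no right child becomes
  eligible, and both lines of descent survive.  Two eternal points with merging orbits contradict
  injectivity.\<close>

lemma merging_eternal_points:
  assumes x: "x \<in> eternal_points \<omega>" and y: "y \<in> eternal_points \<omega>" and "x \<noteq> y"
    and level: "snd x = snd y"
    and hit: "rm_iter \<omega> m y = diag x m"
    and first: "\<And>i. i < m \<Longrightarrow> rm_iter \<omega> i y \<noteq> diag x i"
  shows "\<not> inj_on (rm_step (open_diag \<omega> x m)) (eternal_points (open_diag \<omega> x m))"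
proof
  define \<omega>' where "\<omega>' = open_diag \<omega> x m"
  assume "inj_on (rm_step (open_diag \<omega> x m)) (eternal_points (open_diag \<omega> x m))"
  then have inj: "inj_on (rm_step \<omega>') (eternal_points \<omega>')" by (simp add: \<omega>'_def)
  let ?K = "percolation_points \<omega>" and ?K' = "percolation_points \<omega>'"
  let ?D = "diag_edges x m" and ?C = "side_edges x m"
  have xK: "x \<in> ?K" and yK: "y \<in> ?K" using x y by (auto intro: eternal_point_percolation_point)
  have xl: "x \<in> lattice" using xK by (rule percolation_points_lattice)
  have op: "open_edges \<omega>' = (open_edges \<omega> - ?C) \<union> ?D"
    unfolding \<omega>'_def by (rule open_edges_open_diag[OF xl])
  define S where "S = diag x ` {..<m}"
  \<comment> \<open>The diagonal can be entered from outside only at its origin, which percolates already.\<close>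
  have sub: "?K' \<subseteq> ?K \<union> S"
  proof (rule percolation_points_modified_subset)
    fix u w assume uw: "(u, w) \<in> open_edges \<omega>'"
    show "(u, w) \<in> open_edges \<omega> \<or> u \<in> S"
      using uw by (auto simp: op diag_edges_def S_def)
    assume "w \<in> S"
    then obtain i where i: "i < m" "w = diag x i" by (auto simp: S_def)
    show "u \<in> S \<or> w \<in> ?K"
    proof (cases i)
      case 0
      then show ?thesis using xK i by simp
    next
      case (Suc j)
      have "(u, w) \<notin> ?C \<or> (u, w) \<in> ?D" using uw op by blast
      moreover have "u \<noteq> diag x j \<Longrightarrow> u = (fst x + int i + 1, snd x + int i - 1)"
        using open_edge_cases[OF uw] i Suc by (auto simp: diag_def prod_eq_iff)
      ultimately have "u = diag x j \<or> (u, w) \<in> ?D"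
        using i Suc by (auto simp: side_edges_def image_iff)
      then show ?thesis using i Suc by (auto simp: S_def diag_edges_def)
    qed
  qed
  \<comment> \<open>The closed edges end on the diagonal, which the orbit of \<open>y\<close> avoids before time \<open>m\<close>.\<close>
  have notC: "(rm_iter \<omega> n y, rm_iter \<omega> (Suc n) y) \<notin> ?C" for n
  proof
    assume "(rm_iter \<omega> n y, rm_iter \<omega> (Suc n) y) \<in> ?C"
    then obtain i where i: "i < m" "rm_iter \<omega> (Suc n) y = diag x i"
      by (auto simp: side_edges_def)
    then have "Suc n = i" using snd_rm_iter[of "Suc n" \<omega> y] level by simp
    with i first show False by blast
  qed
  have yop: "(rm_iter \<omega> n y, rm_iter \<omega> (Suc n) y) \<in> open_edges \<omega>'" for n
    using notC[of n] rm_step_percolation_point[OF rm_iter_percolation_point[OF yK, of n]]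
    by (simp add: op)
  have yK': "rm_iter \<omega> n y \<in> ?K'" for n
  proof (rule percolation_point_if_orbit_open)
    show "rm_iter \<omega> n y \<in> ?K" by (rule rm_iter_percolation_point[OF yK])
    show "(rm_iter \<omega> k (rm_iter \<omega> n y), rm_iter \<omega> (Suc k) (rm_iter \<omega> n y)) \<in> open_edges \<omega>'" for k
      using yop[of "k + n"] by (simp add: funpow_add)
  qed
  have dop: "(diag x i, diag x (Suc i)) \<in> open_edges \<omega>'" if "i < m" for i
    using that by (auto simp: op diag_edges_def)
  \<comment> \<open>The diagonal leads to a point on the orbit of \<open>y\<close>.\<close>
  have dK': "diag x i \<in> ?K'" if "i \<le> m" for i
    using that
  proof (induction rule: inc_induct)
    case base
    show ?case using yK'[of m] hit by simp
  next
    case (step i)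
    then show ?case
      using percolation_point_back[of \<omega>' "diag x i" "diag x (Suc i)"] dop[of i] open_edgeD(1)[OF dop[of i]]
      by (auto simp: reaches_def)
  qed
  have xiter: "rm_iter \<omega>' i x = diag x i" if "i \<le> m" for i
    using that
  proof (induction i)
    case (Suc i)
    then show ?case using dop[of i] dK'[of "Suc i"] by (auto simp: rm_step_def diag_Suc)
  qed simp
  \<comment> \<open>The right children of the orbit of \<open>y\<close> are off the diagonal before time \<open>m\<close>.\<close>
  have yiter: "rm_iter \<omega>' i y = rm_iter \<omega> i y" if "i \<le> m" for i
    using that
  proof (induction i)
    case (Suc i)
    let ?R = "rm_iter \<omega> i y"
    have "rm_step \<omega>' ?R = rm_step \<omega> ?R"
    proof (rule rm_step_eqI)
      show "?R \<in> ?K" by (rule rm_iter_percolation_point[OF yK])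
      show "rm_step \<omega> ?R \<in> ?K'" using yK'[of "Suc i"] by simp
      show "(?R, rm_step \<omega> ?R) \<in> open_edges \<omega>'" using yop[of i] by simp
      have ne: "?R \<noteq> diag x j" for j
      proof
        assume a: "?R = diag x j"
        then have "i = j" using snd_rm_iter[of i \<omega> y] level by simp
        then show False using first[of i] Suc.prems a by simp
      qed
      assume "(?R, diag ?R 1) \<in> open_edges \<omega>'" "diag ?R 1 \<in> ?K'"
      moreover have "(?R, diag ?R 1) \<notin> ?D" using ne by (auto simp: diag_edges_def)
      moreover have "diag ?R 1 \<notin> S"
      proof
        assume "diag ?R 1 \<in> S"
        then obtain j where j: "diag ?R 1 = diag x j" by (auto simp: S_def)
        then have "j = Suc i" using level by (auto simp: prod_eq_iff)
        then show False using j ne[of i] by (auto simp: prod_eq_iff)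
      qed
      ultimately show "(?R, diag ?R 1) \<in> open_edges \<omega> \<and> diag ?R 1 \<in> ?K" using sub op by blast
    qed
    then show ?case using Suc by simp
  qed simp
  \<comment> \<open>All edges below the level of \<open>x\<close> are unchanged, and so is the set of percolation points there and
    on that level, except for points that may have been lost.\<close>
  have eternal: "z \<in> eternal_points \<omega>'"
    if z: "z \<in> eternal_points \<omega>" "z \<in> ?K'" "snd z = snd x" for z
    unfolding eternal_points_def has_ancestor_def
  proof safe
    fix n
    obtain u where u: "u \<in> ?K" "rm_iter \<omega> n u = z"
      using z(1) unfolding eternal_points_def has_ancestor_def by blast
    have low: "snd (rm_iter \<omega> i u) \<le> snd x" if "i \<le> n" for i
      using that u(2) z(3) snd_rm_iter[of n \<omega> u] by simp
    have uop: "(rm_iter \<omega> i u, rm_iter \<omega> (Suc i) u) \<in> open_edges \<omega>'" if "i < n" for i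
    proof -
      have "(rm_iter \<omega> i u, rm_iter \<omega> (Suc i) u) \<notin> ?C"
      proof
        assume "(rm_iter \<omega> i u, rm_iter \<omega> (Suc i) u) \<in> ?C"
        then obtain j where "1 \<le> j" "rm_iter \<omega> (Suc i) u = diag x j"
          by (auto simp: side_edges_def)
        then have "snd (rm_iter \<omega> (Suc i) u) > snd x" by (simp only: snd_diag)
        then show False using low[of "Suc i"] that by simp
      qed
      then show ?thesis
        using rm_step_percolation_point[OF rm_iter_percolation_point[OF u(1), of i]] by (simp add: op)
    qed
    have uK': "rm_iter \<omega> i u \<in> ?K'" if "i \<le> n" for i
      using that
    proof (induction rule: inc_induct)
      case base
      show ?case using z u by simp
    next
      case (step i)
      then show ?case
        using percolation_point_back[of \<omega>' "rm_iter \<omega> i u" "rm_iter \<omega> (Suc i) u"] uop[of i] open_edgeD(1)[OF uop[of i]]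
        by (auto simp: reaches_def)
    qed
    have "rm_iter \<omega>' i u = rm_iter \<omega> i u" if "i \<le> n" for i
      using that
    proof (induction i)
      case (Suc i)
      let ?R = "rm_iter \<omega> i u"
      have "rm_step \<omega>' ?R = rm_step \<omega> ?R"
      proof (rule rm_step_eqI)
        show "?R \<in> ?K" by (rule rm_iter_percolation_point[OF u(1)])
        show "rm_step \<omega> ?R \<in> ?K'" using uK'[of "Suc i"] Suc.prems by simp
        show "(?R, rm_step \<omega> ?R) \<in> open_edges \<omega>'" using uop[of i] Suc.prems by simp
        assume *: "(?R, diag ?R 1) \<in> open_edges \<omega>'" "diag ?R 1 \<in> ?K'"
        have lev: "snd ?R + 1 \<le> snd x" using low[of "Suc i"] Suc.prems by simp
        have "?R \<notin> S"
        proof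
          assume "?R \<in> S"
          then obtain j where "?R = diag x j" by (auto simp: S_def)
          then have "snd ?R \<ge> snd x" by (simp only: snd_diag)
          with lev show False by simp
        qed
        then have "(?R, diag ?R 1) \<notin> ?D" by (auto simp: diag_edges_def S_def)
        moreover have "diag ?R 1 \<in> ?K"
        proof (cases "diag ?R 1 \<in> S")
          case True
          then obtain j where j: "diag ?R 1 = diag x j" by (auto simp: S_def)
          have "snd (diag ?R 1) = snd x + int j" unfolding j by simp
          then have "j = 0" using lev by simp
          then show ?thesis using j xK by simp
        next
          case False
          then show ?thesis using * sub by blast
        qed
        ultimately show "(?R, diag ?R 1) \<in> open_edges \<omega> \<and> diag ?R 1 \<in> ?K" using * op by blast
      qed
      then show ?case using Suc by simp
    qed simp
    then have "rm_iter \<omega>' n u = z" using u by simp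
    moreover have "u \<in> ?K'" using uK'[of 0] by simp
    ultimately show "\<exists>u\<in>?K'. rm_iter \<omega>' n u = z" by blast
  qed
  have ex: "x \<in> eternal_points \<omega>'" "y \<in> eternal_points \<omega>'"
    using eternal[of x] eternal[of y] x y dK'[of 0] yK'[of 0] level by auto
  \<comment> \<open>Injectivity on the eternal points keeps distinct orbits distinct.\<close>
  have "rm_iter \<omega>' i x \<noteq> rm_iter \<omega>' i y" for i
  proof (induction i)
    case (Suc i)
    then show ?case
      using inj_on_eq_iff[OF inj eternal_points_rm_iter[OF ex(1)] eternal_points_rm_iter[OF ex(2)], of i i]
      by simp
  qed (use \<open>x \<noteq> y\<close> in simp)
  moreover have "rm_iter \<omega>' m x = rm_iter \<omega>' m y" using xiter yiter hit by simp
  ultimately show False by blast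
qed

text \<open>The horizontal distance from the diagonal to the orbit is even and drops by two with every step to
  the left.  An orbit that never meets the diagonal has only finitely many such steps, so it
  eventually follows an open diagonal.\<close>

lemma orbit_meets_diagonal:
  assumes x: "x \<in> lattice" and y: "y \<in> percolation_points \<omega>"
    and xy: "snd x = snd y" "fst x < fst y"
    and diag: "\<And>v. v \<in> lattice \<Longrightarrow> \<exists>i. (diag v i, diag v (Suc i)) \<notin> open_edges \<omega>"
  shows "\<exists>m. rm_iter \<omega> m y = diag x m"
proof (rule ccontr)
  assume neg: "\<not> ?thesis"
  define d where "d i = fst (rm_iter \<omega> i y) - fst (diag x i)" for i
  have d0: "d i \<noteq> 0" for i
    using neg xy by (auto simp: d_def prod_eq_iff)
  have dl: "diag x i \<in> lattice" for i using x by (auto simp: lattice_parity)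
  have yl: "y \<in> lattice" using y by (rule percolation_points_lattice)
  have pos: "d i > 0" for i
  proof (induction i)
    case 0
    then show ?case using xy by (simp add: d_def)
  next
    case (Suc i)
    have "d i \<ge> 2"
      using level_gap[of "diag x i" "rm_iter \<omega> i y"] Suc dl xy yl by (auto simp: d_def rm_iter_lattice)
    then have "d (Suc i) \<ge> 0" using fst_rm_step[of \<omega> "rm_iter \<omega> i y"] by (auto simp: d_def)
    with d0[of "Suc i"] show ?case by simp
  qed
  have le: "d (Suc i) \<le> d i" for i using fst_rm_step[of \<omega> "rm_iter \<omega> i y"] by (auto simp: d_def)
  obtain N where N: "\<And>j. nat (d N) \<le> nat (d j)"
    using ex_has_least_nat[of "\<lambda>_. True" 0 "\<lambda>i. nat (d i)"] by auto
  have const: "d (N + k) = d N" for k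
  proof (induction k)
    case (Suc k)
    then show ?case using le[of "N + k"] N[of "N + Suc k"] pos[of "N + Suc k"] pos[of N] by simp
  qed simp
  have eq: "rm_iter \<omega> (N + k) y = diag (rm_iter \<omega> N y) k" for k
    using const[of k] by (auto simp: d_def prod_eq_iff)
  have "(diag (rm_iter \<omega> N y) k, diag (rm_iter \<omega> N y) (Suc k)) \<in> open_edges \<omega>" for k
    using eq[of k] eq[of "Suc k"] rm_step_percolation_point(1)[OF rm_iter_percolation_point[OF y, of "N + k"]]
    by simp
  moreover have "rm_iter \<omega> N y \<in> lattice" using yl by (simp add: rm_iter_lattice)
  ultimately show False using diag by blast
qed

section \<open>Classes of coalescing paths\<close>

text \<open>Two percolation points of one level belong to the same class at time \<open>n\<close> if their orbits have met
  by then; \<open>class_top\<close> singles out the right-most member, one for every class.\<close>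

definition class_top :: "config \<Rightarrow> nat \<Rightarrow> vertex \<Rightarrow> bool" where
  "class_top \<omega> n v \<longleftrightarrow> v \<in> percolation_points \<omega> \<and>
     (\<forall>u\<in>percolation_points \<omega>. snd u = snd v \<and> fst v < fst u \<longrightarrow> rm_iter \<omega> n u \<noteq> rm_iter \<omega> n v)"

lemma rm_iter_eq_later:
  assumes "rm_iter \<omega> m u = rm_iter \<omega> m v" "m \<le> n"
  shows "rm_iter \<omega> n u = rm_iter \<omega> n v"
proof -
  have "rm_iter \<omega> n w = rm_iter \<omega> (n - m) (rm_iter \<omega> m w)" for w
    using assms(2) by (metis comp_apply funpow_add le_add_diff_inverse2)
  then show ?thesis using assms(1) by simp
qed

text \<open>Since orbits do not cross, the points of the level of \<open>x\<close> whose orbits ever meet that of \<open>x\<close> all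
  lie to the left of \<open>y\<close>.  The right-most of them can never be met from the right.\<close>

lemma permanent_class_top:
  assumes x: "x \<in> percolation_points \<omega>" and y: "y \<in> percolation_points \<omega>"
    and xy: "snd x = snd y" "fst x < fst y"
    and never: "\<And>n. rm_iter \<omega> n x \<noteq> rm_iter \<omega> n y"
  shows "\<exists>v. \<forall>n. class_top \<omega> n v"
proof -
  have lat: "w \<in> lattice" if "w \<in> percolation_points \<omega>" for w
    using that by (rule percolation_points_lattice)
  define C where "C = {v \<in> percolation_points \<omega>. snd v = snd x \<and> fst x \<le> fst v \<and>
    (\<exists>n. rm_iter \<omega> n v = rm_iter \<omega> n x)}"
  have below: "fst v < fst y" if v: "v \<in> C" for v
  proof (rule ccontr)
    assume ge: "\<not> ?thesis"
    obtain n where n: "rm_iter \<omega> n v = rm_iter \<omega> n x" and vK: "v \<in> percolation_points \<omega>" "snd v = snd x"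
      using v unfolding C_def by blast
    have "fst (rm_iter \<omega> n y) \<le> fst (rm_iter \<omega> n v)" "fst (rm_iter \<omega> n x) \<le> fst (rm_iter \<omega> n y)"
      using ge vK xy lat[OF x] lat[OF y] lat[OF vK(1)] by (auto intro!: rm_iter_mono)
    then have "rm_iter \<omega> n x = rm_iter \<omega> n y" using n xy by (auto simp: prod_eq_iff)
    with never show False by blast
  qed
  have fin: "finite (fst ` C)"
    by (rule finite_subset[of _ "{fst x..fst y}"]) (use below in \<open>force simp: C_def\<close>)+
  moreover have "x \<in> C" using x by (auto simp: C_def)
  ultimately have "Max (fst ` C) \<in> fst ` C" by (intro Max_in) auto
  then obtain v where v: "v \<in> C" "fst v = Max (fst ` C)" by auto
  have vmax: "fst u \<le> fst v" if "u \<in> C" for u using that fin v(2) by simp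
  have "class_top \<omega> n v" for n
    unfolding class_top_def
  proof safe
    show "v \<in> percolation_points \<omega>" using v by (simp add: C_def)
    fix a b assume u: "(a, b) \<in> percolation_points \<omega>" "snd (a, b) = snd v" "fst v < fst (a, b)"
      and eq: "rm_iter \<omega> n (a, b) = rm_iter \<omega> n v"
    obtain m where m: "rm_iter \<omega> m v = rm_iter \<omega> m x" using v by (auto simp: C_def)
    have "rm_iter \<omega> (max m n) (a, b) = rm_iter \<omega> (max m n) x"
      using rm_iter_eq_later[OF m, of "max m n"] rm_iter_eq_later[OF eq, of "max m n"] by simp
    then have "(a, b) \<in> C" using u v unfolding C_def by auto
    with vmax u show False by fastforce
  qed
  then show ?thesis by blast
qed

text \<open>Following the lower orbit up to the higher level reduces to two points on one level.\<close>

lemma coalescence: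
  assumes no: "\<And>v. \<exists>n. \<not> class_top \<omega> n v"
    and u: "u \<in> percolation_points \<omega>" and v: "v \<in> percolation_points \<omega>"
  shows "\<exists>m n. rm_iter \<omega> m u = rm_iter \<omega> n v"
proof -
  have level: "\<exists>n. rm_iter \<omega> n x = rm_iter \<omega> n y"
    if "x \<in> percolation_points \<omega>" "y \<in> percolation_points \<omega>" "snd x = snd y" for x y
  proof (cases "fst x" "fst y" rule: linorder_cases)
    case less
    then show ?thesis using permanent_class_top[of x \<omega> y] that no by blast
  next
    case equal
    then have "x = y" using that(3) by (simp add: prod_eq_iff)
    then show ?thesis by simp
  next
    case greater
    then show ?thesis using permanent_class_top[of y \<omega> x] that no by metis
  qed
  define i j where "i = nat (snd v - snd u)" and "j = nat (snd u - snd v)"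
  then have ij: "snd u + int i = snd v + int j" by simp
  obtain n where "rm_iter \<omega> n (rm_iter \<omega> i u) = rm_iter \<omega> n (rm_iter \<omega> j v)"
    using level[of "rm_iter \<omega> i u" "rm_iter \<omega> j v"] rm_iter_percolation_point u v ij by auto
  then have "rm_iter \<omega> (n + i) u = rm_iter \<omega> (n + j) v" by (simp add: funpow_add)
  then show ?thesis by blast
qed

section \<open>Measurability\<close>

lemma space_perc: "space (perc p) = (\<Pi>\<^sub>E e\<in>lattice_edges. UNIV)"
  by (simp add: perc_def space_PiM)

lemma prob_space_perc: "prob_space (perc p)"
  unfolding perc_def by (intro prob_space_PiM prob_space_measure_pmf)

lemma measurable_open_edge [measurable]: "Measurable.pred (perc p) (\<lambda>\<omega>. e \<in> open_edges \<omega>)"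
proof (cases "e \<in> lattice_edges")
  case True
  have "(\<lambda>\<omega>. \<omega> e) \<in> perc p \<rightarrow>\<^sub>M measure_pmf (bernoulli_pmf p)"
    unfolding perc_def using True by (rule measurable_component_singleton)
  then have "Measurable.pred (perc p) (\<lambda>\<omega>. \<omega> e)"
    by (simp cong: measurable_cong_sets)
  with True show ?thesis by (simp add: open_edges_def)
qed (simp add: open_edges_def)

lemma measurable_reaches [measurable]: "Measurable.pred (perc p) (\<lambda>\<omega>. reaches \<omega> u v)"
proof -
  have [measurable]: "Measurable.pred (perc p) (\<lambda>\<omega>. (u, v) \<in> open_edges \<omega> ^^ n)" for n v
  proof (induction n arbitrary: v)
    case (Suc n)
    note Suc [measurable]
    have "(\<lambda>\<omega>. (u, v) \<in> open_edges \<omega> ^^ Suc n) =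
        (\<lambda>\<omega>. \<exists>w. (u, w) \<in> open_edges \<omega> ^^ n \<and> (w, v) \<in> open_edges \<omega>)"
      by (auto simp: relcomp_unfold fun_eq_iff)
    then show ?case by simp
  qed simp
  show ?thesis unfolding reaches_def rtrancl_power by measurable
qed

lemma measurable_percolation_point [measurable]:
  "Measurable.pred (perc p) (\<lambda>\<omega>. v \<in> percolation_points \<omega>)"
  unfolding percolation_point_iff by measurable

text \<open>Values are compared with a fixed vertex: as there are countably many vertices, all statements
  about the orbits are countable combinations of such events.\<close>

lemma measurable_rm_step [measurable]: "Measurable.pred (perc p) (\<lambda>\<omega>. rm_step \<omega> v = w)"
proof -
  have "(\<lambda>\<omega>. rm_step \<omega> v = w) =
    (\<lambda>\<omega>. if (v, diag v 1) \<in> open_edges \<omega> \<and> diag v 1 \<in> percolation_points \<omega>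
      then diag v 1 = w else (fst v - 1, snd v + 1) = w)"
    by (auto simp: rm_step_def fun_eq_iff)
  then show ?thesis by simp
qed

lemma measurable_rm_iter [measurable]: "Measurable.pred (perc p) (\<lambda>\<omega>. rm_iter \<omega> n v = w)"
proof (induction n arbitrary: w)
  case (Suc n)
  note Suc [measurable]
  have "(\<lambda>\<omega>. rm_iter \<omega> (Suc n) v = w) = (\<lambda>\<omega>. \<exists>z. rm_iter \<omega> n v = z \<and> rm_step \<omega> z = w)"
    by auto
  then show ?case by (simp only:) measurable
qed simp

lemma measurable_has_ancestor [measurable]:
  "Measurable.pred (perc p) (\<lambda>\<omega>. has_ancestor \<omega> n v)"
  unfolding has_ancestor_def Bex_def by measurable

lemma measurable_eternal_point [measurable]:
  "Measurable.pred (perc p) (\<lambda>\<omega>. v \<in> eternal_points \<omega>)"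
  unfolding eternal_points_def mem_Collect_eq by measurable

lemma measurable_class_top [measurable]:
  "Measurable.pred (perc p) (\<lambda>\<omega>. class_top \<omega> n v)"
proof -
  have "(\<lambda>\<omega>. class_top \<omega> n v) = (\<lambda>\<omega>. v \<in> percolation_points \<omega> \<and>
    (\<forall>u. u \<in> percolation_points \<omega> \<and> snd u = snd v \<and> fst v < fst u \<longrightarrow>
      \<not> (\<exists>z. rm_iter \<omega> n u = z \<and> rm_iter \<omega> n v = z)))"
    by (auto simp: class_top_def fun_eq_iff)
  then show ?thesis by (simp only:) measurable
qed

section \<open>Translation invariance\<close>

definition shift :: "vertex \<Rightarrow> config \<Rightarrow> config" where
  "shift a \<omega> = (\<lambda>e\<in>lattice_edges. \<omega> (fst e + a, snd e + a))"

lemma lattice_add: "a \<in> lattice \<Longrightarrow> u + a \<in> lattice \<longleftrightarrow> u \<in> lattice"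
  by (simp add: lattice_parity) presburger

lemma lattice_edges_add:
  assumes "a \<in> lattice"
  shows "(u + a, v + a) \<in> lattice_edges \<longleftrightarrow> (u, v) \<in> lattice_edges"
  using lattice_add[OF assms, of u] by (auto simp: lattice_edges_def prod_eq_iff)

lemma distr_shift:
  assumes a: "a \<in> lattice"
  shows "shift a \<in> perc p \<rightarrow>\<^sub>M perc p" "distr (perc p) (perc p) (shift a) = perc p"
proof -
  let ?f = "\<lambda>e::edge. (fst e + a, snd e + a)" and ?B = "\<lambda>_::edge. measure_pmf (bernoulli_pmf p)"
  have f: "?f e \<in> lattice_edges" if "e \<in> lattice_edges" for e
    using lattice_edges_add[OF a, of "fst e" "snd e"] that by simp
  show "shift a \<in> perc p \<rightarrow>\<^sub>M perc p"
    unfolding perc_def shift_def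
    by (intro measurable_restrict measurable_component_singleton f)
  have "distr (PiM lattice_edges ?B) (PiM lattice_edges (\<lambda>e. ?B (?f e)))
      (\<lambda>\<omega>. \<lambda>e\<in>lattice_edges. \<omega> (?f e)) = PiM lattice_edges (\<lambda>e. ?B (?f e))"
    by (rule distr_PiM_reindex) (use f in \<open>auto simp: inj_on_def prob_space_measure_pmf\<close>)
  then show "distr (perc p) (perc p) (shift a) = perc p"
    by (simp add: perc_def shift_def[abs_def])
qed

lemma open_edges_shift:
  "a \<in> lattice \<Longrightarrow> (u, v) \<in> open_edges (shift a \<omega>) \<longleftrightarrow> (u + a, v + a) \<in> open_edges \<omega>"
  by (auto simp: open_edges_def shift_def lattice_edges_add)

lemma reaches_shift:
  assumes a: "a \<in> lattice"
  shows "reaches (shift a \<omega>) u v \<longleftrightarrow> reaches \<omega> (u + a) (v + a)"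
proof
  assume "reaches (shift a \<omega>) u v"
  then show "reaches \<omega> (u + a) (v + a)"
    unfolding reaches_def
    by (induction rule: rtrancl_induct) (auto simp: open_edges_shift[OF a] intro: rtrancl_into_rtrancl)
next
  have "reaches (shift a \<omega>) u (w - a)" if "reaches \<omega> (u + a) w" for w
    using that unfolding reaches_def
  proof (induction rule: rtrancl_induct)
    case (step y z)
    have "(y - a, z - a) \<in> open_edges (shift a \<omega>)"
      unfolding open_edges_shift[OF a] using step by simp
    with step show ?case by (metis rtrancl_into_rtrancl)
  qed simp
  then show "reaches \<omega> (u + a) (v + a) \<Longrightarrow> reaches (shift a \<omega>) u v" by fastforce
qed

lemma percolation_points_shift:
  assumes a: "a \<in> lattice"
  shows "v \<in> percolation_points (shift a \<omega>) \<longleftrightarrow> v + a \<in> percolation_points \<omega>"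
proof -
  have "(\<exists>x. reaches \<omega> (v + a) ((x, snd v + int n) + a)) \<longleftrightarrow>
      (\<exists>x. reaches \<omega> (v + a) (x, snd (v + a) + int n))" for n
  proof
    assume "\<exists>x. reaches \<omega> (v + a) ((x, snd v + int n) + a)"
    then obtain x where "reaches \<omega> (v + a) ((x, snd v + int n) + a)" ..
    moreover have "(x, snd v + int n) + a = (x + fst a, snd (v + a) + int n)"
      by (simp add: prod_eq_iff)
    ultimately show "\<exists>x. reaches \<omega> (v + a) (x, snd (v + a) + int n)" by metis
  next
    assume "\<exists>x. reaches \<omega> (v + a) (x, snd (v + a) + int n)"
    then obtain x where "reaches \<omega> (v + a) (x, snd (v + a) + int n)" ..
    moreover have "(x, snd (v + a) + int n) = (x - fst a, snd v + int n) + a"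
      by (simp add: prod_eq_iff)
    ultimately show "\<exists>x. reaches \<omega> (v + a) ((x, snd v + int n) + a)" by metis
  qed
  then show ?thesis unfolding percolation_point_iff reaches_shift[OF a] lattice_add[OF a] by simp
qed

lemma rm_step_shift:
  assumes a: "a \<in> lattice"
  shows "rm_step (shift a \<omega>) v + a = rm_step \<omega> (v + a)"
proof -
  have diag: "diag v 1 + a = diag (v + a) 1"
    and left: "(fst v - 1, snd v + 1) + a = (fst (v + a) - 1, snd (v + a) + 1)"
    by (auto simp: prod_eq_iff)
  show ?thesis
    unfolding rm_step_def open_edges_shift[OF a] percolation_points_shift[OF a] diag
    by (simp only: if_distrib[of "\<lambda>u. u + a"] diag left)
qed

lemma rm_iter_shift:
  "a \<in> lattice \<Longrightarrow> rm_iter (shift a \<omega>) n v + a = rm_iter \<omega> n (v + a)"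
  by (induction n) (auto simp: rm_step_shift)

lemma rm_iter_shift_eq_iff:
  "a \<in> lattice \<Longrightarrow> rm_iter (shift a \<omega>) n v = w \<longleftrightarrow> rm_iter \<omega> n (v + a) = w + a"
  by (metis rm_iter_shift add_right_cancel)

lemma ex_add: "(\<exists>u::vertex. P (u + a)) \<longleftrightarrow> (\<exists>u. P u)"
  by (metis diff_add_cancel)

lemma has_ancestor_shift:
  assumes a: "a \<in> lattice"
  shows "has_ancestor (shift a \<omega>) n v \<longleftrightarrow> has_ancestor \<omega> n (v + a)"
  unfolding has_ancestor_def Bex_def percolation_points_shift[OF a] rm_iter_shift_eq_iff[OF a]
  using ex_add[of "\<lambda>u. u \<in> percolation_points \<omega> \<and> rm_iter \<omega> n u = v + a" a] by simp

lemma eternal_points_shift: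
  "a \<in> lattice \<Longrightarrow> v \<in> eternal_points (shift a \<omega>) \<longleftrightarrow> v + a \<in> eternal_points \<omega>"
  by (simp add: eternal_points_def has_ancestor_shift)

lemma class_top_shift:
  assumes a: "a \<in> lattice"
  shows "class_top (shift a \<omega>) n v \<longleftrightarrow> class_top \<omega> n (v + a)"
proof -
  have "class_top \<omega> n (v + a) \<longleftrightarrow> v + a \<in> percolation_points \<omega> \<and>
     \<not> (\<exists>u. u \<in> percolation_points \<omega> \<and> snd u = snd (v + a) \<and> fst (v + a) < fst u \<and>
        rm_iter \<omega> n u = rm_iter \<omega> n (v + a))"
    by (auto simp: class_top_def)
  also have "\<dots> \<longleftrightarrow> v + a \<in> percolation_points \<omega> \<and>
     \<not> (\<exists>u. u + a \<in> percolation_points \<omega> \<and> snd (u + a) = snd (v + a) \<and> fst (v + a) < fst (u + a) \<and>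
        rm_iter \<omega> n (u + a) = rm_iter \<omega> n (v + a))"
    using ex_add[of "\<lambda>u. u \<in> percolation_points \<omega> \<and> snd u = snd (v + a) \<and> fst (v + a) < fst u \<and>
        rm_iter \<omega> n u = rm_iter \<omega> n (v + a)" a] by simp
  also have "\<dots> \<longleftrightarrow> class_top (shift a \<omega>) n v"
    unfolding rm_iter_shift[OF a, symmetric]
    by (auto simp: class_top_def percolation_points_shift[OF a])
  finally show ?thesis by simp
qed

text \<open>The form in which translation invariance is used: the probability of an event seen from a vertex is
  that of the same event seen from a translate of the vertex.\<close>

lemma prob_shift:
  assumes "a \<in> lattice" and [measurable]: "Measurable.pred (perc p) P"
  shows "\<P>(\<omega> in perc p. P (shift a \<omega>)) = \<P>(\<omega> in perc p. P \<omega>)"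
proof -
  note distr_shift(1)[OF assms(1), measurable]
  have "\<P>(\<omega> in perc p. P \<omega>) = measure (distr (perc p) (perc p) (shift a)) {\<omega> \<in> space (perc p). P \<omega>}"
    using distr_shift(2)[OF assms(1)] by simp
  also have "\<dots> = measure (perc p) (shift a -` {\<omega> \<in> space (perc p). P \<omega>} \<inter> space (perc p))"
    by (intro measure_distr) measurable
  also have "shift a -` {\<omega> \<in> space (perc p). P \<omega>} \<inter> space (perc p) =
      {\<omega> \<in> space (perc p). P (shift a \<omega>)}"
    using measurable_space[OF distr_shift(1)[OF assms(1)]] by auto
  finally show ?thesis by simp
qed

section \<open>Finite energy\<close>

locale nondegenerate_percolation =
  fixes p :: real
  assumes p: "0 < p" "p < 1"
begin

sublocale edges: product_prob_space "\<lambda>_::edge. measure_pmf (bernoulli_pmf p)" lattice_edges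
  by unfold_locales

sublocale prob_space "perc p"
  by (rule prob_space_perc)

text \<open>Resampling one edge leaves the measure unchanged, and the resampled state is \<open>b\<close> with positive
  probability independently of the other edges.  So a property that holds almost surely still does
  so when the state of the edge is set to \<open>b\<close>.\<close>

lemma AE_fun_upd:
  assumes e: "e \<in> lattice_edges" and P: "AE \<omega> in perc p. P \<omega>"
  shows "AE \<omega> in perc p. P (fun_upd \<omega> e b)"
proof -
  let ?B = "measure_pmf (bernoulli_pmf p)"
  let ?J = "lattice_edges - {e}"
  let ?M = "PiM ?J (\<lambda>_. ?B)"
  interpret M: prob_space ?M by (intro prob_space_PiM prob_space_measure_pmf)
  interpret B: pair_sigma_finite ?B ?M by unfold_locales
  have ins: "insert e ?J = lattice_edges" using e by auto
  have distr: "distr (?B \<Otimes>\<^sub>M ?M) (perc p) (\<lambda>(x, X). X(e := x)) = perc p"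
    using distr_pair_PiM_eq_PiM[of ?J "\<lambda>_. ?B" e] unfolding ins perc_def
    by (simp add: prob_space_measure_pmf)
  have meas: "(\<lambda>(x, X). X(e := x)) \<in> ?B \<Otimes>\<^sub>M ?M \<rightarrow>\<^sub>M perc p"
    unfolding perc_def
    by (subst ins[symmetric], unfold split_beta')
       (rule measurable_fun_upd[where J = ?J], auto)
  have "AE z in ?B \<Otimes>\<^sub>M ?M. P ((\<lambda>(x, X). X(e := x)) z)"
    by (rule AE_distrD[OF meas], unfold distr, rule P)
  from B.AE_pair[OF this] have "AE x in ?B. AE X in ?M. P (X(e := x))" by simp
  moreover have "b \<in> set_pmf (bernoulli_pmf p)"
    using p by (auto simp: set_pmf_iff)
  ultimately have AE: "AE X in ?M. P (X(e := b))" by (auto simp: AE_measure_pmf_iff)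
  have res: "distr (perc p) ?M (\<lambda>\<omega>. \<lambda>i\<in>?J. \<omega> i) = ?M"
    unfolding perc_def
    using distr_PiM_reindex[of lattice_edges "\<lambda>_. ?B" "\<lambda>e. e" ?J] by (auto simp: prob_space_measure_pmf)
  have meas': "(\<lambda>\<omega>. \<lambda>i\<in>?J. \<omega> i) \<in> perc p \<rightarrow>\<^sub>M ?M"
    unfolding perc_def by (intro measurable_restrict measurable_component_singleton) auto
  \<comment> \<open>Back from the configurations of the other edges to all configurations, whatever the state of \<open>e\<close>.\<close>
  have restr: "AE \<omega> in perc p. P ((\<lambda>i\<in>?J. \<omega> i)(e := b))"
    using AE_distrD[where P = "\<lambda>X. P (X(e := b))", OF meas'] AE unfolding res by blast
  have "AE \<omega> in perc p. P ((\<lambda>i\<in>?J. \<omega> i)(e := b)) \<longrightarrow> P (fun_upd \<omega> e b)"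
  proof (rule AE_I2)
    fix \<omega> assume \<omega>: "\<omega> \<in> space (perc p)"
    have "(\<lambda>i\<in>?J. \<omega> i)(e := b) = fun_upd \<omega> e b"
    proof
      fix i
      show "((\<lambda>i\<in>?J. \<omega> i)(e := b)) i = (fun_upd \<omega> e b) i"
        using PiE_arb[of \<omega> lattice_edges _ i] \<omega> by (cases "i \<in> lattice_edges") (auto simp: space_perc)
    qed
    then show "P ((\<lambda>i\<in>?J. \<omega> i)(e := b)) \<longrightarrow> P (fun_upd \<omega> e b)" by simp
  qed
  with restr show ?thesis by (rule AE_mp)
qed

lemma AE_override_on:
  assumes "finite S" "S \<subseteq> lattice_edges" "AE \<omega> in perc p. P \<omega>"
  shows "AE \<omega> in perc p. P (override_on \<omega> f S)"
  using assms
proof (induction S arbitrary: P)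
  case (insert e S)
  have "AE \<omega> in perc p. P (fun_upd \<omega> e (f e))" using insert.prems by (intro AE_fun_upd) auto
  then have "AE \<omega> in perc p. P ((override_on \<omega> f S)(e := f e))"
    using insert.IH[of "\<lambda>\<omega>. P (fun_upd \<omega> e (f e))"] insert.prems by auto
  then show ?case by (simp only: override_on_insert)
qed simp

lemma AE_open_diag:
  assumes v: "v \<in> lattice" and P: "AE \<omega> in perc p. P \<omega>"
  shows "AE \<omega> in perc p. P (open_diag \<omega> v m)"
  unfolding open_diag_def
proof (rule AE_override_on[OF _ _ P])
  show "finite (diag_edges v m \<union> side_edges v m)" by (simp add: diag_edges_def side_edges_def)
  show "diag_edges v m \<union> side_edges v m \<subseteq> lattice_edges"
    using v by (auto simp: diag_edges_def side_edges_def lattice_edges_def lattice_parity diag_def)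
qed

text \<open>The first \<open>n\<close> edges of a diagonal are all open with probability \<open>p ^ n\<close>.\<close>

lemma AE_no_open_diagonal:
  "AE \<omega> in perc p. \<forall>v\<in>lattice. \<exists>i. (diag v i, diag v (Suc i)) \<notin> open_edges \<omega>"
proof -
  have "AE \<omega> in perc p. \<exists>i. (diag v i, diag v (Suc i)) \<notin> open_edges \<omega>" if v: "v \<in> lattice" for v
  proof -
    have sub: "diag_edges v n \<subseteq> lattice_edges" for n
      using v by (auto simp: diag_edges_def lattice_edges_def lattice_parity diag_def)
    let ?Q = "\<lambda>\<omega>. \<forall>i. (diag v i, diag v (Suc i)) \<in> open_edges \<omega>"
    have le: "\<P>(\<omega> in perc p. ?Q \<omega>) \<le> p ^ n" for n
    proof -
      have card: "card (diag_edges v n) = n"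
        unfolding diag_edges_def by (subst card_image) (auto simp: inj_on_def)
      let ?A = "{\<omega> \<in> space (perc p). \<forall>e\<in>diag_edges v n. \<omega> e \<in> {True}}"
      have fin: "finite (diag_edges v n)" by (simp add: diag_edges_def)
      have A: "?A \<in> sets (perc p)"
      proof -
        have "?A = {\<omega> \<in> space (perc p). \<forall>e\<in>diag_edges v n. e \<in> open_edges \<omega>}"
          using sub by (auto simp: open_edges_def)
        then show ?thesis using fin by simp
      qed
      have "emeasure (perc p) ?A = (\<Prod>e\<in>diag_edges v n. emeasure (measure_pmf (bernoulli_pmf p)) {True})"
        unfolding perc_def by (rule edges.emeasure_PiM_Collect[OF sub fin]) auto
      also have "\<dots> = ennreal (p ^ n)"
        using p by (simp add: emeasure_pmf_single card ennreal_power)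
      finally have "measure (perc p) ?A = p ^ n" using p by (simp add: measure_def)
      moreover have "\<P>(\<omega> in perc p. ?Q \<omega>) \<le> measure (perc p) ?A"
        by (rule finite_measure_mono[OF _ A]) (auto simp: diag_edges_def open_edges_def)
      ultimately show ?thesis by simp
    qed
    have "(\<lambda>n. p ^ n) \<longlonglongrightarrow> 0" using p by (intro LIMSEQ_realpow_zero) auto
    then have "\<P>(\<omega> in perc p. ?Q \<omega>) \<le> 0" by (rule LIMSEQ_le_const) (use le in blast)
    then have "\<P>(\<omega> in perc p. ?Q \<omega>) = 0" by (simp add: antisym)
    then have "AE \<omega> in perc p. \<not> ?Q \<omega>" by (subst (asm) prob_Collect_eq_0) auto
    then show ?thesis by simp
  qed
  then show ?thesis by (simp add: AE_ball_countable)
qed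

section \<open>There are no eternal points\<close>

text \<open>Mass transport: let every eternal point send mass one to its successor, which is eternal again.  By
  translation invariance a vertex \<open>v\<close> receives on average what it sends, namely the probability that
  \<open>v\<close> is eternal.  An eternal point has at least one eternal parent, so it almost surely never has two.\<close>

lemma AE_inj_on_eternal_points:
  "AE \<omega> in perc p. inj_on (rm_step \<omega>) (eternal_points \<omega>)"
proof -
  have "AE \<omega> in perc p. \<not> (v + (-1, -1) \<in> eternal_points \<omega> \<and> rm_step \<omega> (v + (-1, -1)) = v \<and>
      v + (1, -1) \<in> eternal_points \<omega> \<and> rm_step \<omega> (v + (1, -1)) = v)" for v
  proof -
    \<comment> \<open>\<open>E a\<close>: mass arrives from \<open>v + a\<close>; \<open>F a\<close>: mass is sent to \<open>v - a\<close>.\<close>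
    define E where "E a = {\<omega> \<in> space (perc p). v + a \<in> eternal_points \<omega> \<and> rm_step \<omega> (v + a) = v}" for a
    define F where "F a = {\<omega> \<in> space (perc p). v \<in> eternal_points \<omega> \<and> rm_step \<omega> v = v - a}" for a
    let ?l = "(-1, -1) :: vertex" and ?r = "(1, -1) :: vertex"
    have [measurable]: "E a \<in> sets (perc p)" "F a \<in> sets (perc p)" for a
      unfolding E_def F_def by measurable
    have EF: "prob (E a) = prob (F a)" if a: "a \<in> lattice" for a
    proof -
      have "E a = {\<omega> \<in> space (perc p). v \<in> eternal_points (shift a \<omega>) \<and> rm_step (shift a \<omega>) v = v - a}"
        unfolding E_def eternal_points_shift[OF a] rm_step_shift[OF a, symmetric]
        by (auto simp: eq_diff_eq)
      then show ?thesis
        unfolding F_def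
        using prob_shift[OF a, where p = p and P = "\<lambda>\<omega>. v \<in> eternal_points \<omega> \<and> rm_step \<omega> v = v - a"] by simp
    qed
    have lat: "?l \<in> lattice" "?r \<in> lattice" by (auto simp: lattice_def)
    have step: "rm_step \<omega> v = v - ?l \<or> rm_step \<omega> v = v - ?r" for \<omega>
      using fst_rm_step[of \<omega> v] by (auto simp: prod_eq_iff)
    have par: "v + ?l = (fst v - 1, snd v - 1)" "v + ?r = (fst v + 1, snd v - 1)"
      by (auto simp: prod_eq_iff)
    have "E ?l \<union> E ?r = F ?l \<union> F ?r"
    proof (rule set_eqI)
      fix \<omega>
      have "v \<in> eternal_points \<omega>" if "u \<in> eternal_points \<omega>" "rm_step \<omega> u = v" for u
        using eternal_points_rm_step[OF that(1)] that(2) by simp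
      then show "\<omega> \<in> E ?l \<union> E ?r \<longleftrightarrow> \<omega> \<in> F ?l \<union> F ?r"
        unfolding E_def F_def using step[of \<omega>] eternal_point_parent[of v \<omega>]
        unfolding par by auto
    qed
    moreover have "prob (F ?l \<union> F ?r) = prob (F ?l) + prob (F ?r)"
    proof (rule finite_measure_Union)
      show "F ?l \<inter> F ?r = {}" by (auto simp: F_def prod_eq_iff)
    qed measurable
    ultimately have "prob (E ?l \<union> E ?r) = prob (E ?l) + prob (E ?r)"
      using EF lat by simp
    moreover have "prob (E ?l \<union> E ?r) = prob (E ?l) + prob (E ?r) - prob (E ?l \<inter> E ?r)"
      by (rule measure_Un3) (auto simp: fmeasurable_eq_sets)
    ultimately have "prob (E ?l \<inter> E ?r) = 0" by simp
    then have "AE \<omega> in perc p. \<omega> \<notin> E ?l \<inter> E ?r" by (subst (asm) prob_eq_0) auto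
    then show ?thesis by (rule AE_mp[OF _ AE_I2]) (auto simp: E_def)
  qed
  then have "AE \<omega> in perc p. \<forall>v. \<not> (v + (-1, -1) \<in> eternal_points \<omega> \<and> rm_step \<omega> (v + (-1, -1)) = v \<and>
      v + (1, -1) \<in> eternal_points \<omega> \<and> rm_step \<omega> (v + (1, -1)) = v)"
    unfolding AE_all_countable by (rule allI)
  then show ?thesis
  proof (rule AE_mp[OF _ AE_I2], intro impI inj_onI)
    fix \<omega> u w
    assume no: "\<forall>v. \<not> (v + (-1, -1) \<in> eternal_points \<omega> \<and> rm_step \<omega> (v + (-1, -1)) = v \<and>
      v + (1, -1) \<in> eternal_points \<omega> \<and> rm_step \<omega> (v + (1, -1)) = v)"
      and uw: "u \<in> eternal_points \<omega>" "w \<in> eternal_points \<omega>" "rm_step \<omega> u = rm_step \<omega> w"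
    obtain v where v: "rm_step \<omega> u = v" "rm_step \<omega> w = v" using uw(3) by blast
    have "z = v + (-1, -1) \<or> z = v + (1, -1)" if "rm_step \<omega> z = v" for z
      using rm_step_parents[OF that] by (auto simp: prod_eq_iff)
    from this[OF v(1)] this[OF v(2)] show "u = w"
      using no[THEN spec, of v] uw(1,2) v by blast
  qed
qed

text \<open>If two eternal points shared a level with positive probability, then by finite energy the
  configurations in which two eternal points merge would have positive probability as well.\<close>

lemma AE_eternal_points_unique_on_level:
  "AE \<omega> in perc p. \<forall>x\<in>eternal_points \<omega>. \<forall>y\<in>eternal_points \<omega>. snd x = snd y \<longrightarrow> x = y"
proof -
  let ?I = "\<lambda>\<omega>. inj_on (rm_step \<omega>) (eternal_points \<omega>)"
  have "AE \<omega> in perc p. ?I (open_diag \<omega> v m)" if "v \<in> lattice" for v m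
    by (rule AE_open_diag[OF that AE_inj_on_eternal_points])
  then have "AE \<omega> in perc p. \<forall>v\<in>lattice. \<forall>m. ?I (open_diag \<omega> v m)"
    by (simp add: AE_ball_countable AE_all_countable)
  with AE_no_open_diagonal show ?thesis
  proof eventually_elim
    fix \<omega>
    assume diag: "\<forall>v\<in>lattice. \<exists>i. (diag v i, diag v (Suc i)) \<notin> open_edges \<omega>"
      and inj: "\<forall>v\<in>lattice. \<forall>m. ?I (open_diag \<omega> v m)"
    have "\<not> fst x < fst y"
      if xy: "x \<in> eternal_points \<omega>" "y \<in> eternal_points \<omega>" "snd x = snd y" for x y
    proof
      assume less: "fst x < fst y"
      have xl: "x \<in> lattice"
        using xy by (auto intro: percolation_points_lattice eternal_point_percolation_point)
      have "\<exists>m. rm_iter \<omega> m y = diag x m"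
        using xl xy less diag
        by (intro orbit_meets_diagonal) (auto intro: eternal_point_percolation_point)
      then obtain m where m: "rm_iter \<omega> m y = diag x m" "\<And>i. i < m \<Longrightarrow> rm_iter \<omega> i y \<noteq> diag x i"
        using exists_least_iff[of "\<lambda>m. rm_iter \<omega> m y = diag x m"] by blast
      show False
        using merging_eternal_points[OF xy(1,2) _ xy(3) m] less inj xl by auto
    qed
    note not_left = this
    show "\<forall>x\<in>eternal_points \<omega>. \<forall>y\<in>eternal_points \<omega>. snd x = snd y \<longrightarrow> x = y"
    proof (intro ballI impI prod_eqI)
      fix x y assume "x \<in> eternal_points \<omega>" "y \<in> eternal_points \<omega>" "snd x = snd y"
      then show "fst x = fst y" using not_left[of x y] not_left[of y x] by simp
    qed
  qed
qed

text \<open>The translates of the event along a level are almost surely disjoint and equally likely.\<close>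

lemma prob_eternal_point: "\<P>(\<omega> in perc p. v \<in> eternal_points \<omega>) = 0"
proof -
  let ?q = "\<P>(\<omega> in perc p. v \<in> eternal_points \<omega>)"
  define F where "F i = {\<omega> \<in> space (perc p). v + (2 * int i, 0) \<in> eternal_points \<omega>}" for i :: nat
  have [measurable]: "F i \<in> sets (perc p)" for i unfolding F_def by measurable
  have F: "prob (F i) = ?q" for i
  proof -
    have a: "(2 * int i, 0) \<in> lattice" by (simp add: lattice_def)
    show ?thesis unfolding F_def eternal_points_shift[OF a, symmetric] by (rule prob_shift[OF a]) simp
  qed
  have le: "real n * ?q \<le> 1" for n
  proof -
    have "measure (perc p) (\<Union>i\<in>{..<n}. F i) = (\<Sum>i\<in>{..<n}. measure (perc p) (F i))"
    proof (rule measure_UNION_AE)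
      show "pairwise (\<lambda>i j. AE \<omega> in perc p. \<omega> \<notin> F i \<or> \<omega> \<notin> F j) {..<n}"
        unfolding pairwise_def
      proof (intro ballI impI)
        fix i j :: nat assume "i \<noteq> j"
        show "AE \<omega> in perc p. \<omega> \<notin> F i \<or> \<omega> \<notin> F j"
          using AE_eternal_points_unique_on_level
        proof (rule AE_mp[OF _ AE_I2], intro impI)
          fix \<omega> assume uniq: "\<forall>x\<in>eternal_points \<omega>. \<forall>y\<in>eternal_points \<omega>. snd x = snd y \<longrightarrow> x = y"
          show "\<omega> \<notin> F i \<or> \<omega> \<notin> F j"
          proof (rule ccontr)
            assume "\<not> ?thesis"
            then have "v + (2 * int i, 0) \<in> eternal_points \<omega>" "v + (2 * int j, 0) \<in> eternal_points \<omega>"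
              by (simp_all add: F_def)
            moreover have "snd (v + (2 * int i, 0)) = snd (v + (2 * int j, 0))" by simp
            ultimately have "v + (2 * int i, 0) = v + (2 * int j, 0)" using uniq by blast
            with \<open>i \<noteq> j\<close> show False by simp
          qed
        qed
      qed
    qed (auto simp: fmeasurable_eq_sets)
    then have "real n * ?q = prob (\<Union>i\<in>{..<n}. F i)" by (simp add: F)
    then show ?thesis by simp
  qed
  have "\<not> ?q > 0"
  proof
    assume "?q > 0"
    then obtain n where "1 < real n * ?q" using reals_Archimedean3[of ?q] by blast
    with le[of n] show False by linarith
  qed
  then show ?thesis using measure_nonneg[of "perc p"] by (meson antisym not_less)
qed

lemma AE_no_eternal_points: "AE \<omega> in perc p. eternal_points \<omega> = {}"
proof -
  have "AE \<omega> in perc p. v \<notin> eternal_points \<omega>" for v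
    using prob_eternal_point[of v] by (subst (asm) prob_Collect_eq_0) auto
  then have "AE \<omega> in perc p. \<forall>v. v \<notin> eternal_points \<omega>"
    unfolding AE_all_countable by (rule allI)
  then show ?thesis by eventually_elim blast
qed

section \<open>All paths coalesce\<close>

text \<open>Mass transport again: let every class top send mass one to the point where the orbits of its class
  are after \<open>n\<close> steps.  A vertex receives at most one unit, and only if it has an ancestor
  \<open>n\<close> levels below.\<close>

lemma prob_class_top_le:
  assumes v: "v \<in> lattice"
  shows "\<P>(\<omega> in perc p. class_top \<omega> n v) \<le> \<P>(\<omega> in perc p. has_ancestor \<omega> n v)"
proof -
  \<comment> \<open>Only displacements of the right parity are lattice vectors, hence symmetries.\<close>
  define Z where "Z = {z \<in> {- int n..int n}. even (z + int n)}"
  define F where "F z = {\<omega> \<in> space (perc p). class_top \<omega> n v \<and> rm_iter \<omega> n v = v + (z, int n)}" for z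
  define G where "G z = {\<omega> \<in> space (perc p). class_top \<omega> n (v - (z, int n)) \<and>
    rm_iter \<omega> n (v - (z, int n)) = v}" for z
  have meas: "Measurable.pred (perc p) (\<lambda>\<omega>. class_top \<omega> n u \<and> rm_iter \<omega> n u = w)" for u w
    by (intro pred_intros_logic measurable_class_top measurable_rm_iter)
  then have [measurable]: "F z \<in> sets (perc p)" "G z \<in> sets (perc p)" for z
    unfolding F_def G_def pred_def by blast+
  have fin: "finite Z" unfolding Z_def by (rule finite_subset[of _ "{- int n..int n}"]) blast+
  have FG: "prob (F z) = prob (G z)" if z: "z \<in> Z" for z
  proof -
    have a: "(- z, - int n) \<in> lattice" using z by (simp add: lattice_def Z_def)
    have minus: "v - (z, int n) = v + (- z, - int n)" and cancel: "v + (z, int n) + (- z, - int n) = v"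
      by (auto simp: prod_eq_iff)
    have "G z = {\<omega> \<in> space (perc p). class_top (shift (- z, - int n) \<omega>) n v \<and>
        rm_iter (shift (- z, - int n) \<omega>) n v = v + (z, int n)}"
      unfolding G_def class_top_shift[OF a] rm_iter_shift_eq_iff[OF a] minus cancel ..
    then show ?thesis
      unfolding F_def
      using prob_shift[OF a, where p = p and P = "\<lambda>\<omega>. class_top \<omega> n v \<and> rm_iter \<omega> n v = v + (z, int n)", OF meas]
      by simp
  qed
  have "{\<omega> \<in> space (perc p). class_top \<omega> n v} \<subseteq> (\<Union>z\<in>Z. F z)"
  proof safe
    fix \<omega> assume \<omega>: "\<omega> \<in> space (perc p)" "class_top \<omega> n v"
    let ?z = "fst (rm_iter \<omega> n v) - fst v"
    have "even (fst v + snd v)" "even (fst (rm_iter \<omega> n v) + (snd v + int n))"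
      using v rm_iter_lattice[of n \<omega> v] by (auto simp: lattice_parity)
    then have "even (?z + int n)" by presburger
    moreover have "\<bar>?z\<bar> \<le> int n" by (rule fst_rm_iter_le)
    ultimately have "?z \<in> Z" by (auto simp: Z_def)
    moreover have "\<omega> \<in> F ?z" using \<omega> by (simp add: F_def prod_eq_iff)
    ultimately show "\<omega> \<in> (\<Union>z\<in>Z. F z)" by blast
  qed
  then have "\<P>(\<omega> in perc p. class_top \<omega> n v) \<le> prob (\<Union>z\<in>Z. F z)"
    by (rule finite_measure_mono) (use fin in auto)
  also have "\<dots> \<le> (\<Sum>z\<in>Z. prob (F z))"
    by (rule finite_measure_subadditive_finite[OF fin]) auto
  also have "\<dots> = (\<Sum>z\<in>Z. prob (G z))" using FG by simp
  also have "\<dots> = prob (\<Union>z\<in>Z. G z)"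
  proof (rule finite_measure_finite_Union[symmetric, OF fin])
    show "disjoint_family_on G Z"
      unfolding disjoint_family_on_def
    proof (intro ballI impI, rule ccontr)
      fix z w assume "z \<noteq> w" "G z \<inter> G w \<noteq> {}"
      then obtain \<omega> where \<omega>: "\<omega> \<in> G z" "\<omega> \<in> G w" by blast
      have "\<not> i < j" if ij: "\<omega> \<in> G i" "\<omega> \<in> G j" for i j
      proof
        assume "i < j"
        let ?a = "v - (i, int n)" and ?b = "v - (j, int n)"
        have top: "class_top \<omega> n ?a" "class_top \<omega> n ?b"
          and merge: "rm_iter \<omega> n ?a = rm_iter \<omega> n ?b"
          using ij by (simp_all add: G_def)
        have "snd ?a = snd ?b" "fst ?b < fst ?a" using \<open>i < j\<close> by simp_all
        with top merge show False unfolding class_top_def by blast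
      qed
      from this[OF \<omega>] this[OF \<omega>(2,1)] show False using \<open>z \<noteq> w\<close> by simp
    qed
  qed auto
  also have "\<dots> \<le> \<P>(\<omega> in perc p. has_ancestor \<omega> n v)"
  proof (rule finite_measure_mono)
    show "(\<Union>z\<in>Z. G z) \<subseteq> {\<omega> \<in> space (perc p). has_ancestor \<omega> n v}"
      by (auto simp: G_def class_top_def has_ancestor_def)
  qed measurable
  finally show ?thesis .
qed

text \<open>A permanent class top at \<open>v\<close> has at most the probability that \<open>v\<close> has an ancestor \<open>n\<close> levels
  below, for every \<open>n\<close>.  In the limit this is the probability that \<open>v\<close> is eternal.\<close>

lemma AE_not_permanent_class_top:
  "AE \<omega> in perc p. \<forall>v. \<exists>n. \<not> class_top \<omega> n v"
proof -
  have "AE \<omega> in perc p. \<exists>n. \<not> class_top \<omega> n v" for v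
  proof (cases "v \<in> lattice")
    case True
    let ?A = "\<lambda>n. {\<omega> \<in> space (perc p). has_ancestor \<omega> n v}"
    have "(\<lambda>n. prob (?A n)) \<longlonglongrightarrow> prob (\<Inter>n. ?A n)"
      by (rule finite_Lim_measure_decseq) (auto simp: decseq_def intro: has_ancestor_antimono)
    also have "(\<Inter>n. ?A n) = {\<omega> \<in> space (perc p). v \<in> eternal_points \<omega>}"
      by (auto simp: eternal_points_def)
    finally have lim: "(\<lambda>n. prob (?A n)) \<longlonglongrightarrow> 0" by (simp add: prob_eternal_point)
    have le: "\<P>(\<omega> in perc p. \<forall>n. class_top \<omega> n v) \<le> prob (?A n)" for n
    proof -
      have "\<P>(\<omega> in perc p. \<forall>n. class_top \<omega> n v) \<le> \<P>(\<omega> in perc p. class_top \<omega> n v)"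
        by (rule finite_measure_mono) auto
      with prob_class_top_le[OF True, of n] show ?thesis by linarith
    qed
    have "\<P>(\<omega> in perc p. \<forall>n. class_top \<omega> n v) \<le> 0"
      by (rule LIMSEQ_le_const[OF lim]) (use le in blast)
    then have "\<P>(\<omega> in perc p. \<forall>n. class_top \<omega> n v) = 0" by (simp add: antisym)
    then have "AE \<omega> in perc p. \<not> (\<forall>n. class_top \<omega> n v)" by (subst (asm) prob_Collect_eq_0) auto
    then show ?thesis by simp
  next
    case False
    then show ?thesis by (auto simp: class_top_def dest: percolation_points_lattice)
  qed
  then show ?thesis unfolding AE_all_countable by (rule allI)
qed

section \<open>Existence of percolation points\<close>

text \<open>Orbits climb above every level, so closing edges below a level cannot destroy all
  percolation points.\<close>

lemma percolation_points_nonempty_iff_above: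
  assumes above: "\<And>e. e \<in> lattice_edges \<Longrightarrow> n \<le> snd (fst e) \<Longrightarrow> \<omega>' e = \<omega> e"
    and below: "\<And>e. e \<in> lattice_edges \<Longrightarrow> \<omega>' e \<Longrightarrow> \<omega> e"
  shows "percolation_points \<omega>' \<noteq> {} \<longleftrightarrow> percolation_points \<omega> \<noteq> {}"
proof
  have "open_edges \<omega>' \<subseteq> open_edges \<omega>" using below by (auto simp: open_edges_def)
  then show "percolation_points \<omega>' \<noteq> {} \<Longrightarrow> percolation_points \<omega> \<noteq> {}"
    using percolation_points_mono by blast
next
  assume "percolation_points \<omega> \<noteq> {}"
  then obtain u where u: "u \<in> percolation_points \<omega>" by blast
  let ?v = "rm_iter \<omega> (nat (n - snd u)) u"
  have v: "?v \<in> percolation_points \<omega>" using u by (rule rm_iter_percolation_point)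
  have "?v \<in> percolation_points \<omega>'"
  proof (rule percolation_point_if_orbit_open[OF v])
    fix k
    have "(rm_iter \<omega> k ?v, rm_iter \<omega> (Suc k) ?v) \<in> open_edges \<omega>"
      using rm_step_percolation_point(1)[OF rm_iter_percolation_point[OF v]] by simp
    moreover have "n \<le> snd (rm_iter \<omega> k ?v)" by simp
    ultimately show "(rm_iter \<omega> k ?v, rm_iter \<omega> (Suc k) ?v) \<in> open_edges \<omega>'"
      using above[of "(rm_iter \<omega> k ?v, rm_iter \<omega> (Suc k) ?v)"] unfolding open_edges_def by simp
  qed
  then show "percolation_points \<omega>' \<noteq> {}" by blast
qed

lemma indep_edges: "indep_vars (\<lambda>_. measure_pmf (bernoulli_pmf p)) (\<lambda>e \<omega>. \<omega> e) lattice_edges"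
proof (subst indep_vars_iff_distr_eq_PiM')
  let ?B = "\<lambda>_::edge. measure_pmf (bernoulli_pmf p)"
  have "((0, 0), (1, 1)) \<in> lattice_edges" by (simp add: lattice_edges_def lattice_def)
  then show "lattice_edges \<noteq> {}" by blast
  show "random_variable (?B e) (\<lambda>\<omega>. \<omega> e)" if "e \<in> lattice_edges" for e
    unfolding perc_def using that by (rule measurable_component_singleton)
  have "distr (perc p) (PiM lattice_edges ?B) (\<lambda>\<omega>. \<lambda>e\<in>lattice_edges. \<omega> e) =
      distr (perc p) (perc p) (\<lambda>\<omega>. \<omega>)"
    by (rule distr_cong) (auto simp: perc_def space_PiM PiE_restrict)
  also have "\<dots> = PiM lattice_edges (\<lambda>e. distr (perc p) (?B e) (\<lambda>\<omega>. \<omega> e))"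
    unfolding distr_id unfolding perc_def by (rule PiM_cong) (simp_all add: edges.PiM_component)
  finally show "distr (perc p) (PiM lattice_edges ?B) (\<lambda>\<omega>. \<lambda>e\<in>lattice_edges. \<omega> e) =
      PiM lattice_edges (\<lambda>e. distr (perc p) (?B e) (\<lambda>\<omega>. \<omega> e))" .
qed

text \<open>Kolmogorov's zero-one law with the edges grouped by level.  The event is in the tail because it can
  be read off the configuration \<open>T \<omega>\<close> in which all edges below level \<open>n\<close> are closed.\<close>

lemma prob_percolation_points_nonempty:
  "\<P>(\<omega> in perc p. percolation_points \<omega> \<noteq> {}) \<in> {0, 1}"
proof -
  let ?B = "measure_pmf (bernoulli_pmf p)"
  define E where "E = (\<lambda>e. {(\<lambda>\<omega>. \<omega> e) -` A \<inter> space (perc p) | A. A \<in> sets ?B})"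
  define L where "L j = {e \<in> lattice_edges. snd (fst e) = int j}" for j
  define A where "A j = sigma_sets (space (perc p)) (\<Union>e\<in>L j. E e)" for j
  have Esub: "E e \<subseteq> Pow (space (perc p))" for e by (auto simp: E_def)
  have indep: "indep_sets E lattice_edges"
    using indep_edges unfolding indep_vars_def2 E_def by (rule conjunct2)
  have "indep_sets A UNIV"
    unfolding A_def
  proof (rule indep_sets_collect_sigma)
    show "indep_sets E (\<Union>j\<in>UNIV. L j)"
      by (rule indep_sets_mono_index[OF _ indep]) (auto simp: L_def)
    show "disjoint_family_on L UNIV" by (auto simp: disjoint_family_on_def L_def)
    show "Int_stable (E e)" for e
    proof (rule Int_stableI)
      fix a b assume "a \<in> E e" "b \<in> E e"
      then obtain a' b' where "a = (\<lambda>\<omega>. \<omega> e) -` a' \<inter> space (perc p)"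
        "b = (\<lambda>\<omega>. \<omega> e) -` b' \<inter> space (perc p)" by (auto simp: E_def)
      then have "a \<inter> b = (\<lambda>\<omega>. \<omega> e) -` (a' \<inter> b') \<inter> space (perc p)" by auto
      then show "a \<inter> b \<in> E e"
        unfolding E_def by (intro CollectI exI[of _ "a' \<inter> b'"] conjI) simp_all
    qed
  qed
  moreover have "sigma_algebra (space (perc p)) (A j)" for j
    unfolding A_def by (rule sigma_algebra_sigma_sets) (use Esub in blast)
  moreover have "{\<omega> \<in> space (perc p). percolation_points \<omega> \<noteq> {}} \<in> tail_events A"
    unfolding tail_events_def
  proof
    fix n :: nat
    let ?G = "\<Union> (A ` {n..})"
    define N where "N = sigma (space (perc p)) ?G"
    have "A j \<subseteq> Pow (space (perc p))" for j
      using sigma_sets_into_sp[of "\<Union>e\<in>L j. E e" "space (perc p)"] Esub unfolding A_def by blast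
    then have "?G \<subseteq> Pow (space (perc p))" by blast
    then have N: "sets N = sigma_sets (space (perc p)) ?G" "space N = space (perc p)"
      unfolding N_def by (rule sets_measure_of, rule space_measure_of)
    define T where "T \<omega> = (\<lambda>e\<in>lattice_edges. if int n \<le> snd (fst e) then \<omega> e else False)" for \<omega> :: config
    have "T \<in> N \<rightarrow>\<^sub>M perc p"
      unfolding perc_def T_def
    proof (rule measurable_restrict)
      fix e assume e: "e \<in> lattice_edges"
      show "(\<lambda>\<omega>. if int n \<le> snd (fst e) then \<omega> e else False) \<in> N \<rightarrow>\<^sub>M ?B"
      proof (cases "int n \<le> snd (fst e)")
        case True
        have "(\<lambda>\<omega>. \<omega> e) -` X \<inter> space N \<in> sets N" for X
        proof -
          let ?j = "nat (snd (fst e))"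
          have "(\<lambda>\<omega>. \<omega> e) -` X \<inter> space N \<in> E e" by (auto simp: E_def N)
          moreover have "e \<in> L ?j" "?j \<in> {n..}" using True e by (auto simp: L_def)
          ultimately have "(\<lambda>\<omega>. \<omega> e) -` X \<inter> space N \<in> ?G"
            unfolding A_def by (intro UN_I[of ?j]) (auto intro!: sigma_sets.Basic)
          then show ?thesis unfolding N(1) by (rule sigma_sets.Basic)
        qed
        then have "(\<lambda>\<omega>. \<omega> e) \<in> N \<rightarrow>\<^sub>M ?B" by (intro measurableI) simp_all
        then show ?thesis using True by simp
      qed simp
    qed
    moreover have "Measurable.pred (perc p) (\<lambda>\<omega>. \<exists>v. v \<in> percolation_points \<omega>)" by measurable
    ultimately have "Measurable.pred N (\<lambda>\<omega>. \<exists>v. v \<in> percolation_points (T \<omega>))"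
      by (rule measurable_compose)
    then have "{\<omega> \<in> space N. \<exists>v. v \<in> percolation_points (T \<omega>)} \<in> sets N" by simp
    also have "(\<lambda>\<omega>. \<exists>v. v \<in> percolation_points (T \<omega>)) = (\<lambda>\<omega>. percolation_points \<omega> \<noteq> {})"
    proof
      fix \<omega>
      have "percolation_points (T \<omega>) \<noteq> {} \<longleftrightarrow> percolation_points \<omega> \<noteq> {}"
        by (rule percolation_points_nonempty_iff_above[where n = "int n"])
           (auto simp: T_def split: if_splits)
      then show "(\<exists>v. v \<in> percolation_points (T \<omega>)) \<longleftrightarrow> percolation_points \<omega> \<noteq> {}" by auto
    qed
    finally show "{\<omega> \<in> space (perc p). percolation_points \<omega> \<noteq> {}} \<in> sigma_sets (space (perc p)) ?G"
      by (simp add: N)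
  qed
  ultimately show ?thesis using kolmogorov_0_1_law[of A] by blast
qed

lemma AE_percolation_points_nonempty:
  assumes "theta p \<noteq> 0"
  shows "AE \<omega> in perc p. percolation_points \<omega> \<noteq> {}"
proof -
  have meas: "Measurable.pred (perc p) (\<lambda>\<omega>. percolation_points \<omega> \<noteq> {})"
    unfolding ex_in_conv[symmetric] by measurable
  have "theta p = \<P>(\<omega> in perc p. (0, 0) \<in> percolation_points \<omega>)"
    by (simp add: theta_def percolation_points_def lattice_def)
  also have "\<dots> \<le> \<P>(\<omega> in perc p. percolation_points \<omega> \<noteq> {})"
    using meas by (intro finite_measure_mono) auto
  finally have "\<P>(\<omega> in perc p. percolation_points \<omega> \<noteq> {}) \<noteq> 0"
    using assms measure_nonneg[of "perc p" "{\<omega> \<in> space (perc p). infinite (cluster \<omega> (0, 0))}"]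
    unfolding theta_def by linarith
  then have "\<P>(\<omega> in perc p. percolation_points \<omega> \<noteq> {}) = 1"
    using prob_percolation_points_nonempty by blast
  then show ?thesis using meas by (subst (asm) prob_Collect_eq_1) auto
qed

end

section \<open>The supercritical phase\<close>

text \<open>This puts zero among the parameters over which \<open>critical_prob\<close> is the supremum, so that
  supercritical parameters are positive.\<close>

lemma theta_0: "theta 0 = 0"
proof -
  interpret product_prob_space "\<lambda>_::edge. measure_pmf (bernoulli_pmf 0)" lattice_edges
    by unfold_locales
  have "AE \<omega> in perc 0. e \<notin> open_edges \<omega>" for e
  proof (cases "e \<in> lattice_edges")
    case True
    have "AE b in measure_pmf (bernoulli_pmf 0). \<not> b"
      unfolding AE_measure_pmf_iff
    proof
      fix b assume "b \<in> set_pmf (bernoulli_pmf 0)"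
      then show "\<not> b" by (cases b) (simp_all add: set_pmf_iff)
    qed
    from AE_component[OF True this] show ?thesis
      unfolding perc_def by eventually_elim (simp add: open_edges_def)
  qed (simp add: open_edges_def)
  then have "AE \<omega> in perc 0. \<forall>e. e \<notin> open_edges \<omega>"
    unfolding AE_all_countable by (rule allI)
  then have "AE \<omega> in perc 0. (0, 0) \<notin> percolation_points \<omega>"
    by (rule AE_mp[OF _ AE_I2]) (auto elim: percolation_point_child)
  then have "emeasure (perc 0) {\<omega> \<in> space (perc 0). (0, 0) \<in> percolation_points \<omega>} = 0"
    by (subst (asm) AE_iff_measurable[OF _ refl]) auto
  then show ?thesis
    by (simp add: theta_def percolation_points_def lattice_def measure_def)
qed

lemma supercritical:
  assumes "critical_prob < p" "p \<le> 1"
  shows "0 < p" "theta p \<noteq> 0"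
proof -
  have bdd: "bdd_above {p \<in> {0..1}. theta p = 0}" by (rule bdd_aboveI[of _ 1]) auto
  then have "0 \<le> critical_prob"
    unfolding critical_prob_def by (intro cSup_upper) (auto simp: theta_0)
  then show "0 < p" using assms by simp
  then show "theta p \<noteq> 0"
    using assms cSup_upper[OF _ bdd, of p] unfolding critical_prob_def by auto
qed

theorem corollary1p2:
  fixes p :: real
  assumes "critical_prob < p" and "p < 1"
  shows "AE \<omega> in perc p.
           card (topological_ends (percolation_points \<omega>) (rightmost_edges \<omega>)) = 1"
proof -
  have pos: "0 < p" and theta: "theta p \<noteq> 0" using supercritical[of p] assms by auto
  interpret nondegenerate_percolation p
    using pos assms by unfold_locales
  show ?thesis
    using AE_percolation_points_nonempty[OF theta] AE_no_eternal_points AE_not_permanent_class_top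
  proof eventually_elim
    fix \<omega>
    assume "percolation_points \<omega> \<noteq> {}" "eternal_points \<omega> = {}" "\<forall>v. \<exists>n. \<not> class_top \<omega> n v"
    then show "card (topological_ends (percolation_points \<omega>) (rightmost_edges \<omega>)) = 1"
      by (intro one_end coalescence) auto
  qed
qed

end
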